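(* Let $(M,E)$ be a Finsler manifold and let $V$ be a vertical vector field on $TM$. If the $[J,V]$-Ehresmann connection $\mathbf{h}_{[J,V]}=\mathbf{h}_0+[J,V]+[J,(d_{[J,V]}E)^{\#}]$ is conservative (i.e. $d_{\mathbf{h}_{[J,V]}}E=0$), then the vector field $U:=V+(d_{[J,V]}E)^{\#}$ is a conservative vector field, i.e. $i_U\omega=d_J(UE)$.
   Context: $M$ is a connected smooth $n$-dimensional manifold (Hausdorff, countable base), $TM$ its tangent bundle, $\overset{\circ}{T}M\subset TM$ the open submanifold of nonzero tangent vectors. $C$ is the Liouville vector field on $TM$ and $J$ is the vertical endomorphism of $TM$ (the $(1,1)$ tensor with image and kernel the vertical vector fields, $[J,J]=0$, $[J,C]=J$). A vector $1$-form is a $(1,1)$ tensor field. For a vector $1$-form $K$ and a function $\varphi$, $d_K\varphi:=d\varphi\circ K$. For a vector field $Y$, $[K,Y]$ is the vector $1$-form $[K,Y]X=[KX,Y]-K[X,Y]$. A vector $1$-form $L$ is semibasic if $L\circ J=0$ and $J\circ L=0$ (for $V$ vertical, $[J,V]$ is semibasic). A Finsler manifold $(M,E)$: $E:TM\to\mathbb{R}$ with $E(0)=0$, $E>0$ on $\overset{\circ}{T}M$, $E$ of class $C^1$ on $TM$ and smooth on $\overset{\circ}{T}M$, $E$ positively homogeneous of degree $2$ ($CE=2E$), and the fundamental $2$-form $\omega:=d\,d_JE$ nondegenerate. For a $1$-form $\beta$, $\beta^{\#}$ is the unique vector field (smooth in general only on $\overset{\circ}{T}M$) with $i_{\beta^{\#}}\omega=\beta$.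 An Ehresmann connection is a vector $1$-form $\mathbf{h}$ (smooth in general only on $\overset{\circ}{T}M$) with $\mathbf{h}^2=\mathbf{h}$ and $\ker\mathbf{h}$ the vertical vector fields; it is conservative with respect to $E$ if $d_{\mathbf{h}}E=0$. The canonical spray is $S_0:=-(dE)^{\#}$ over $\overset{\circ}{T}M$, $S_0(0):=0$; the Berwald connection is $\mathbf{h}_0:=\frac12(\mathrm{id}+[J,S_0])$. For a semibasic vector $1$-form $L$, the $L$-Ehresmann connection is $\mathbf{h}_L:=\mathbf{h}_0+L+[J,(d_LE)^{\#}]$. A vertical vector field $W$ is conservative on $(M,E)$ (in Vincze's sense) if $i_W\omega=d_J(WE)$. *)

theory Defs
  imports "HOL-Analysis.Analysis" "HOL-Library.Function_Algebras"
begin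

text \<open>Differentiability classes on open subsets of a Euclidean space.\<close>

primrec Ck_on :: "nat \<Rightarrow> 'e::euclidean_space set \<Rightarrow> ('e \<Rightarrow> 'f::real_normed_vector) \<Rightarrow> bool" where
  "Ck_on 0 S f \<longleftrightarrow> continuous_on S f"
| "Ck_on (Suc k) S f \<longleftrightarrow> (\<forall>x\<in>S. f differentiable (at x)) \<and>
     (\<forall>u. Ck_on k S (\<lambda>x. frechet_derivative f (at x) u))"

definition smooth_on :: "'e::euclidean_space set \<Rightarrow> ('e \<Rightarrow> 'f::real_normed_vector) \<Rightarrow> bool" where
  "smooth_on S f \<longleftrightarrow> (\<forall>k. Ck_on k S f)"


section \<open>Manifolds\<close>

text \<open>A manifold modelled on the Euclidean space \<open>'e\<close> (so of dimension \<open>DIM('e)\<close>) is given by an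
  atlas, not necessarily maximal. A chart is a domain together with a map that matters only on that
  domain. The underlying set is the union of the chart domains, and its topology is the one
  determined by the charts; the Hausdorff property and the countable base are imposed on it.\<close>

type_synonym ('a, 'e) chart = "'a set \<times> ('a \<Rightarrow> 'e)"

definition chart_inv :: "('a, 'e) chart \<Rightarrow> 'e \<Rightarrow> 'a" where
  "chart_inv c = inv_into (fst c) (snd c)"

definition transition :: "('a, 'e) chart \<Rightarrow> ('a, 'e) chart \<Rightarrow> 'e \<Rightarrow> 'e" where
  "transition c d = snd d \<circ> chart_inv c"

definition carrier :: "('a, 'e) chart set \<Rightarrow> 'a set" where
  "carrier A = (\<Union>c\<in>A. fst c)"

definition charts_at :: "('a, 'e) chart set \<Rightarrow> 'a \<Rightarrow> ('a, 'e) chart set" where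
  "charts_at A p = {c \<in> A. p \<in> fst c}"

definition smooth_atlas :: "('a, 'e::euclidean_space) chart set \<Rightarrow> bool" where
  "smooth_atlas A \<longleftrightarrow>
     (\<forall>c\<in>A. inj_on (snd c) (fst c) \<and> open (snd c ` fst c)) \<and>
     (\<forall>c\<in>A. \<forall>d\<in>A. open (snd c ` (fst c \<inter> fst d)) \<and>
        smooth_on (snd c ` (fst c \<inter> fst d)) (transition c d))"

definition atlas_topology :: "('a, 'e::euclidean_space) chart set \<Rightarrow> 'a topology" where
  "atlas_topology A = topology (\<lambda>W. W \<subseteq> carrier A \<and> (\<forall>c\<in>A. open (snd c ` (W \<inter> fst c))))"

lemma openin_atlas_topology:
  assumes "smooth_atlas A"
  shows "openin (atlas_topology A) W \<longleftrightarrow>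
    W \<subseteq> carrier A \<and> (\<forall>c\<in>A. open (snd c ` (W \<inter> fst c)))"
proof -
  let ?P = "\<lambda>W. W \<subseteq> carrier A \<and> (\<forall>c\<in>A. open (snd c ` (W \<inter> fst c)))"
  have inj: "inj_on (snd c) (fst c)" if "c \<in> A" for c
    using assms that by (auto simp: smooth_atlas_def)
  have "?P (S \<inter> T)" if S: "?P S" and T: "?P T" for S T
  proof -
    have "snd c ` ((S \<inter> T) \<inter> fst c) = snd c ` (S \<inter> fst c) \<inter> snd c ` (T \<inter> fst c)"
      if "c \<in> A" for c
      using inj[OF that] by (auto simp: inj_on_def)
    then show ?thesis using S T by auto
  qed
  moreover have "?P (\<Union>\<K>)" if "\<forall>K\<in>\<K>. ?P K" for \<K>
  proof -
    have "open (snd c ` (\<Union>\<K> \<inter> fst c))" if "c \<in> A" for c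
    proof -
      have "snd c ` (\<Union>\<K> \<inter> fst c) = (\<Union>K\<in>\<K>. snd c ` (K \<inter> fst c))" by auto
      then show ?thesis using \<open>\<forall>K\<in>\<K>. ?P K\<close> \<open>c \<in> A\<close> by (simp only:) (blast intro: open_UN)
    qed
    then show ?thesis using that by blast
  qed
  ultimately have "istopology ?P" unfolding istopology_def by blast
  then show ?thesis unfolding atlas_topology_def by (simp add: topology_inverse')
qed

definition smooth_manifold :: "('a, 'e::euclidean_space) chart set \<Rightarrow> bool" where
  "smooth_manifold A \<longleftrightarrow> smooth_atlas A \<and>
     Hausdorff_space (atlas_topology A) \<and> second_countable (atlas_topology A)"

definition Ck_fun ::
    "('a, 'e::euclidean_space) chart set \<Rightarrow> nat \<Rightarrow> 'a set \<Rightarrow> ('a \<Rightarrow> real) \<Rightarrow> bool" where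
  "Ck_fun A k W f \<longleftrightarrow> (\<forall>c\<in>A. Ck_on k (snd c ` (W \<inter> fst c)) (f \<circ> chart_inv c))"

definition smooth_fun ::
    "('a, 'e::euclidean_space) chart set \<Rightarrow> 'a set \<Rightarrow> ('a \<Rightarrow> real) \<Rightarrow> bool" where
  "smooth_fun A W f \<longleftrightarrow> (\<forall>k. Ck_fun A k W f)"


section \<open>Tangent vectors and tensor fields\<close>

text \<open>A tangent vector is the family of its components in the charts around the base point, subject
  to the transformation rule; the family is set to zero at all other charts. Sums, differences and
  the zero vector are pointwise.\<close>

type_synonym ('a, 'e) tvec = "('a, 'e) chart \<Rightarrow> 'e"

definition tangent_space :: "('a, 'e::euclidean_space) chart set \<Rightarrow> 'a \<Rightarrow> ('a, 'e) tvec set" where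
  "tangent_space A p = {v.
     (\<forall>c\<in>charts_at A p. \<forall>d\<in>charts_at A p.
        v d = frechet_derivative (transition c d) (at (snd c p)) (v c)) \<and>
     (\<forall>c. c \<notin> charts_at A p \<longrightarrow> v c = 0)}"

definition vscale :: "real \<Rightarrow> ('a, 'e::real_vector) tvec \<Rightarrow> ('a, 'e) tvec" where
  "vscale r v = (\<lambda>c. r *\<^sub>R v c)"

definition velocity :: "('a, 'e::euclidean_space) chart set \<Rightarrow> (real \<Rightarrow> 'a) \<Rightarrow> ('a, 'e) tvec" where
  "velocity A \<gamma> =
     (\<lambda>c. if c \<in> charts_at A (\<gamma> 0) then vector_derivative (snd c \<circ> \<gamma>) (at 0) else 0)"

definition tangent_map ::
    "('a, 'e::euclidean_space) chart set \<Rightarrow> ('b, 'f::euclidean_space) chart set \<Rightarrow>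
     ('a \<Rightarrow> 'b) \<Rightarrow> 'a \<Rightarrow> ('a, 'e) tvec \<Rightarrow> ('b, 'f) tvec" where
  "tangent_map A B F p v = (THE w. w \<in> tangent_space B (F p) \<and>
     (\<forall>c\<in>charts_at A p. \<forall>d\<in>charts_at B (F p).
        w d = frechet_derivative (snd d \<circ> F \<circ> chart_inv c) (at (snd c p)) (v c)))"

text \<open>Vector fields, 1-forms, vector 1-forms and 2-forms are functions of the base point; only their
  values over the open set under consideration and on tangent vectors matter. Smoothness is local,
  so tensor fields defined over an open subset \<open>W\<close> are treated with the atlas of the whole
  manifold.\<close>

definition vector_field ::
    "('a, 'e::euclidean_space) chart set \<Rightarrow> 'a set \<Rightarrow> ('a \<Rightarrow> ('a, 'e) tvec) \<Rightarrow> bool" where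
  "vector_field A W X \<longleftrightarrow> (\<forall>p\<in>W. X p \<in> tangent_space A p) \<and>
     (\<forall>c\<in>A. smooth_on (snd c ` (W \<inter> fst c)) (\<lambda>x. X (chart_inv c x) c))"

definition differential ::
    "('a, 'e::euclidean_space) chart set \<Rightarrow> ('a \<Rightarrow> real) \<Rightarrow> 'a \<Rightarrow> ('a, 'e) tvec \<Rightarrow> real" where
  "differential A f p v = (THE r. \<forall>c\<in>charts_at A p.
     r = frechet_derivative (f \<circ> chart_inv c) (at (snd c p)) (v c))"

definition lie_deriv ::
    "('a, 'e::euclidean_space) chart set \<Rightarrow> ('a \<Rightarrow> ('a, 'e) tvec) \<Rightarrow> ('a \<Rightarrow> real) \<Rightarrow> 'a \<Rightarrow> real" where
  "lie_deriv A X f p = differential A f p (X p)"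

text \<open>The bracket at \<open>p\<close> is the tangent vector at \<open>p\<close> acting as the commutator on functions that
  are smooth near \<open>p\<close>.\<close>

definition lie_bracket ::
    "('a, 'e::euclidean_space) chart set \<Rightarrow> ('a \<Rightarrow> ('a, 'e) tvec) \<Rightarrow> ('a \<Rightarrow> ('a, 'e) tvec) \<Rightarrow>
     'a \<Rightarrow> ('a, 'e) tvec" where
  "lie_bracket A X Y p = (THE z. z \<in> tangent_space A p \<and>
     (\<forall>W f. openin (atlas_topology A) W \<and> p \<in> W \<and> smooth_fun A W f \<longrightarrow>
        differential A f p z =
          lie_deriv A X (lie_deriv A Y f) p - lie_deriv A Y (lie_deriv A X f) p))"

text \<open>The values at \<open>p\<close> of \<open>[K,Y]\<close> and of \<open>d\<beta>\<close> are obtained from \<open>[K,Y]X = [KX,Y] - K[X,Y]\<close> and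
  \<open>d\<beta>(X,Y) = X(\<beta>(Y)) - Y(\<beta>(X)) - \<beta>([X,Y])\<close> by extending tangent vectors to local smooth vector
  fields; the result does not depend on the extensions. No factor 1/2 occurs in \<open>d\<beta>\<close>.\<close>

definition FN_bracket ::
    "('a, 'e::euclidean_space) chart set \<Rightarrow> ('a \<Rightarrow> ('a, 'e) tvec \<Rightarrow> ('a, 'e) tvec) \<Rightarrow>
     ('a \<Rightarrow> ('a, 'e) tvec) \<Rightarrow> 'a \<Rightarrow> ('a, 'e) tvec \<Rightarrow> ('a, 'e) tvec" where
  "FN_bracket A K Y p v = (THE z. \<forall>W X.
     openin (atlas_topology A) W \<and> p \<in> W \<and> vector_field A W X \<and> X p = v \<longrightarrow>
       z = lie_bracket A (\<lambda>q. K q (X q)) Y p - K p (lie_bracket A X Y p))"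

definition ext_deriv ::
    "('a, 'e::euclidean_space) chart set \<Rightarrow> ('a \<Rightarrow> ('a, 'e) tvec \<Rightarrow> real) \<Rightarrow>
     'a \<Rightarrow> ('a, 'e) tvec \<Rightarrow> ('a, 'e) tvec \<Rightarrow> real" where
  "ext_deriv A \<beta> p v w = (THE r. \<forall>W X Y.
     openin (atlas_topology A) W \<and> p \<in> W \<and> vector_field A W X \<and> vector_field A W Y \<and>
     X p = v \<and> Y p = w \<longrightarrow>
       r = lie_deriv A X (\<lambda>q. \<beta> q (Y q)) p - lie_deriv A Y (\<lambda>q. \<beta> q (X q)) p
           - \<beta> p (lie_bracket A X Y p))"

definition d_along ::
    "('a, 'e::euclidean_space) chart set \<Rightarrow> ('a \<Rightarrow> ('a, 'e) tvec \<Rightarrow> ('a, 'e) tvec) \<Rightarrow>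
     ('a \<Rightarrow> real) \<Rightarrow> 'a \<Rightarrow> ('a, 'e) tvec \<Rightarrow> real" where
  "d_along A K f p v = differential A f p (K p v)"


section \<open>The tangent bundle\<close>

type_synonym ('a, 'e) tpoint = "'a \<times> ('a, 'e) tvec"

definition tangent_bundle :: "('a, 'e::euclidean_space) chart set \<Rightarrow> ('a, 'e) tpoint set" where
  "tangent_bundle A = Sigma (carrier A) (tangent_space A)"

definition slit_bundle :: "('a, 'e::euclidean_space) chart set \<Rightarrow> ('a, 'e) tpoint set" where
  "slit_bundle A = {p \<in> tangent_bundle A. snd p \<noteq> 0}"

definition tangent_chart ::
    "('a, 'e::euclidean_space) chart set \<Rightarrow> ('a, 'e) chart \<Rightarrow> (('a, 'e) tpoint, 'e \<times> 'e) chart" where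
  "tangent_chart A c = (Sigma (fst c) (tangent_space A), \<lambda>(x, v). (snd c x, v c))"

definition tangent_atlas ::
    "('a, 'e::euclidean_space) chart set \<Rightarrow> (('a, 'e) tpoint, 'e \<times> 'e) chart set" where
  "tangent_atlas A = tangent_chart A ` A"

definition proj_map ::
    "('a, 'e::euclidean_space) chart set \<Rightarrow> ('a, 'e) tpoint \<Rightarrow>
     (('a, 'e) tpoint, 'e \<times> 'e) tvec \<Rightarrow> ('a, 'e) tvec" where
  "proj_map A = tangent_map (tangent_atlas A) A fst"

definition vertical_lift ::
    "('a, 'e::euclidean_space) chart set \<Rightarrow> ('a, 'e) tpoint \<Rightarrow> ('a, 'e) tvec \<Rightarrow>
     (('a, 'e) tpoint, 'e \<times> 'e) tvec" where
  "vertical_lift A p w = velocity (tangent_atlas A) (\<lambda>t. (fst p, snd p + vscale t w))"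

definition liouville ::
    "('a, 'e::euclidean_space) chart set \<Rightarrow> ('a, 'e) tpoint \<Rightarrow> (('a, 'e) tpoint, 'e \<times> 'e) tvec" where
  "liouville A p = vertical_lift A p (snd p)"

definition vertical_endo ::
    "('a, 'e::euclidean_space) chart set \<Rightarrow> ('a, 'e) tpoint \<Rightarrow>
     (('a, 'e) tpoint, 'e \<times> 'e) tvec \<Rightarrow> (('a, 'e) tpoint, 'e \<times> 'e) tvec" where
  "vertical_endo A p \<xi> = vertical_lift A p (proj_map A p \<xi>)"

definition vertical_field ::
    "('a, 'e::euclidean_space) chart set \<Rightarrow> ('a, 'e) tpoint set \<Rightarrow>
     (('a, 'e) tpoint \<Rightarrow> (('a, 'e) tpoint, 'e \<times> 'e) tvec) \<Rightarrow> bool" where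
  "vertical_field A W X \<longleftrightarrow> vector_field (tangent_atlas A) W X \<and> (\<forall>p\<in>W. proj_map A p (X p) = 0)"

definition J_bracket ::
    "('a, 'e::euclidean_space) chart set \<Rightarrow>
     (('a, 'e) tpoint \<Rightarrow> (('a, 'e) tpoint, 'e \<times> 'e) tvec) \<Rightarrow>
     ('a, 'e) tpoint \<Rightarrow> (('a, 'e) tpoint, 'e \<times> 'e) tvec \<Rightarrow> (('a, 'e) tpoint, 'e \<times> 'e) tvec" where
  "J_bracket A Y = FN_bracket (tangent_atlas A) (vertical_endo A) Y"


section \<open>Finsler manifolds\<close>

definition fundamental_form ::
    "('a, 'e::euclidean_space) chart set \<Rightarrow> (('a, 'e) tpoint \<Rightarrow> real) \<Rightarrow> ('a, 'e) tpoint \<Rightarrow>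
     (('a, 'e) tpoint, 'e \<times> 'e) tvec \<Rightarrow> (('a, 'e) tpoint, 'e \<times> 'e) tvec \<Rightarrow> real" where
  "fundamental_form A E =
     ext_deriv (tangent_atlas A) (d_along (tangent_atlas A) (vertical_endo A) E)"

text \<open>As \<open>E\<close> need not be of class \<open>C\<^sup>2\<close> along the zero section, the fundamental form and everything
  derived from it are considered over the slit tangent bundle.\<close>

definition finsler_manifold ::
    "('a, 'e::euclidean_space) chart set \<Rightarrow> (('a, 'e) tpoint \<Rightarrow> real) \<Rightarrow> bool" where
  "finsler_manifold A E \<longleftrightarrow>
     smooth_manifold A \<and> connected_space (atlas_topology A) \<and>
     (\<forall>x\<in>carrier A. E (x, 0) = 0) \<and>
     (\<forall>p\<in>slit_bundle A. E p > 0) \<and>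
     Ck_fun (tangent_atlas A) 1 (tangent_bundle A) E \<and>
     smooth_fun (tangent_atlas A) (slit_bundle A) E \<and>
     (\<forall>p\<in>tangent_bundle A. lie_deriv (tangent_atlas A) (liouville A) E p = 2 * E p) \<and>
     (\<forall>p\<in>slit_bundle A. \<forall>v\<in>tangent_space (tangent_atlas A) p.
        (\<forall>w\<in>tangent_space (tangent_atlas A) p. fundamental_form A E p v w = 0) \<longrightarrow> v = 0)"

definition sharp ::
    "('a, 'e::euclidean_space) chart set \<Rightarrow> (('a, 'e) tpoint \<Rightarrow> real) \<Rightarrow>
     (('a, 'e) tpoint \<Rightarrow> (('a, 'e) tpoint, 'e \<times> 'e) tvec \<Rightarrow> real) \<Rightarrow>
     ('a, 'e) tpoint \<Rightarrow> (('a, 'e) tpoint, 'e \<times> 'e) tvec" where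
  "sharp A E \<beta> p = (THE v. v \<in> tangent_space (tangent_atlas A) p \<and>
     (\<forall>w\<in>tangent_space (tangent_atlas A) p. fundamental_form A E p v w = \<beta> p w))"

definition canonical_spray ::
    "('a, 'e::euclidean_space) chart set \<Rightarrow> (('a, 'e) tpoint \<Rightarrow> real) \<Rightarrow>
     ('a, 'e) tpoint \<Rightarrow> (('a, 'e) tpoint, 'e \<times> 'e) tvec" where
  "canonical_spray A E p =
     (if p \<in> slit_bundle A then - sharp A E (differential (tangent_atlas A) E) p else 0)"

definition berwald_connection ::
    "('a, 'e::euclidean_space) chart set \<Rightarrow> (('a, 'e) tpoint \<Rightarrow> real) \<Rightarrow>
     ('a, 'e) tpoint \<Rightarrow> (('a, 'e) tpoint, 'e \<times> 'e) tvec \<Rightarrow> (('a, 'e) tpoint, 'e \<times> 'e) tvec" where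
  "berwald_connection A E p v = vscale (1/2) (v + J_bracket A (canonical_spray A E) p v)"

definition L_connection ::
    "('a, 'e::euclidean_space) chart set \<Rightarrow> (('a, 'e) tpoint \<Rightarrow> real) \<Rightarrow>
     (('a, 'e) tpoint \<Rightarrow> (('a, 'e) tpoint, 'e \<times> 'e) tvec \<Rightarrow> (('a, 'e) tpoint, 'e \<times> 'e) tvec) \<Rightarrow>
     ('a, 'e) tpoint \<Rightarrow> (('a, 'e) tpoint, 'e \<times> 'e) tvec \<Rightarrow> (('a, 'e) tpoint, 'e \<times> 'e) tvec" where
  "L_connection A E L =
     berwald_connection A E + L + J_bracket A (sharp A E (d_along (tangent_atlas A) L E))"

definition conservative_connection ::
    "('a, 'e::euclidean_space) chart set \<Rightarrow> (('a, 'e) tpoint \<Rightarrow> real) \<Rightarrow>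
     (('a, 'e) tpoint \<Rightarrow> (('a, 'e) tpoint, 'e \<times> 'e) tvec \<Rightarrow> (('a, 'e) tpoint, 'e \<times> 'e) tvec) \<Rightarrow>
     bool" where
  "conservative_connection A E h \<longleftrightarrow>
     (\<forall>p\<in>slit_bundle A. \<forall>v\<in>tangent_space (tangent_atlas A) p. d_along (tangent_atlas A) h E p v = 0)"

definition conservative_field ::
    "('a, 'e::euclidean_space) chart set \<Rightarrow> (('a, 'e) tpoint \<Rightarrow> real) \<Rightarrow>
     (('a, 'e) tpoint \<Rightarrow> (('a, 'e) tpoint, 'e \<times> 'e) tvec) \<Rightarrow> bool" where
  "conservative_field A E W \<longleftrightarrow> vertical_field A (slit_bundle A) W \<and>
     (\<forall>p\<in>slit_bundle A. \<forall>v\<in>tangent_space (tangent_atlas A) p.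
        fundamental_form A E p (W p) v =
        d_along (tangent_atlas A) (vertical_endo A) (lie_deriv (tangent_atlas A) W E) p v)"

end

theory Submission
  imports Defs
begin

text \<open>In a chart \<open>(x, y)\<close> of the tangent bundle, write \<open>D2 E\<close> for the second derivative of \<open>E\<close>.
  The vertical endomorphism is \<open>J (a, b) = (0, a)\<close>, the bracket with a vector field \<open>Y\<close> is
  \<open>[J,Y] v = DY (J v) - J (DY v)\<close>, and \<open>\<omega>(v, w) = D2 E (v, J w) - D2 E (w, J v)\<close>
  (\<open>J_bracket_chart\<close>, \<open>fundamental_form_chart\<close>). Three observations prove the theorem.

  If \<open>U\<close> is vertical, then \<open>\<omega>(U, v) = D2 E (U, J v)\<close> and, by the product rule,
  \<open>d\<^sub>J (U E) (v) = D2 E (J v, U) + dE ([J,U] v)\<close>. Since second derivatives are symmetric, \<open>U\<close> is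
  conservative as soon as \<open>dE \<circ> [J,U] = 0\<close> (\<open>conservative_fieldI\<close>).

  The field \<open>U = V + W\<close>, where \<open>W\<close> is the sharp of \<open>dE \<circ> [J,V]\<close>, is indeed a smooth vertical field over
  the slit bundle: the 1-form vanishes on vertical vectors, and the Hessian of \<open>E\<close> along the fibres is
  nondegenerate (\<open>vertical_field_sharp\<close>). Smoothness amounts to smooth dependence of the solution of a
  linear system on its coefficients (\<open>smooth_on_linear_solution\<close>).

  The connection in the hypothesis equals \<open>h + [J,U]\<close> with \<open>h\<close> the Berwald connection, because the
  bracket with \<open>J\<close> is additive. The Berwald connection is itself conservative
  (\<open>berwald_connection_annihilates_E\<close>): homogeneity of \<open>E\<close> shows that the spray \<open>S\<close> has base component
  \<open>y\<close>, and differentiating \<open>S E = 0\<close> along the fibre yields \<open>dE \<circ> h = 0\<close>. So the hypothesis says exactly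
  that \<open>dE \<circ> [J,U] = 0\<close>.

  Most of the work is to obtain the chart expressions. All the operations on a manifold are
  characterized by what they do to test functions or to arbitrary local extensions of tangent
  vectors. Coordinate functions as test functions and fields with constant components as extensions
  determine the values, and symmetry of second derivatives (\<open>D2_symmetric\<close>) provides existence.\<close>

section \<open>Differentiability classes on open sets\<close>

abbreviation fd :: "('a::real_normed_vector \<Rightarrow> 'b::real_normed_vector) \<Rightarrow> 'a \<Rightarrow> 'a \<Rightarrow> 'b" where
  "fd f x \<equiv> frechet_derivative f (at x)"

text \<open>Expanding in the standard basis reduces a family of linear maps to finitely many vector-valued
  functions, so that derivatives and smoothness of \<open>L x (g x)\<close> follow from sums and products.\<close>

lemma linear_basis_sum:
  fixes L :: "'e::euclidean_space \<Rightarrow> 'f::real_vector"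
  assumes "linear L"
  shows "L v = (\<Sum>i\<in>Basis. (v \<bullet> i) *\<^sub>R L i)"
proof -
  have "L v = L (\<Sum>i\<in>Basis. (v \<bullet> i) *\<^sub>R i)" by (simp add: euclidean_representation)
  also have "\<dots> = (\<Sum>i\<in>Basis. (v \<bullet> i) *\<^sub>R L i)"
    using assms by (simp add: linear_sum linear_scale o_def)
  finally show ?thesis .
qed

lemma fd_eqI: "(f has_derivative f') (at x) \<Longrightarrow> fd f x = f'"
  using frechet_derivative_at by metis

lemma fd_works: "f differentiable (at x) \<Longrightarrow> (f has_derivative fd f x) (at x)"
  using frechet_derivative_works by blast

lemma fd_linear: "f differentiable (at x) \<Longrightarrow> linear (fd f x)"
  by (rule linear_frechet_derivative)

lemma has_derivative_cong_nhds:
  assumes "eventually (\<lambda>z. f z = g z) (nhds x)" "(f has_derivative f') (at x)"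
  shows "(g has_derivative f') (at x)"
proof -
  obtain S where "open S" "x \<in> S" "\<And>z. z \<in> S \<Longrightarrow> f z = g z"
    using assms(1) unfolding eventually_nhds by blast
  then show ?thesis using has_derivative_transform_within_open[OF assms(2)] by blast
qed

lemma differentiable_cong_nhds:
  assumes "eventually (\<lambda>z. f z = g z) (nhds x)"
  shows "f differentiable (at x) \<longleftrightarrow> g differentiable (at x)"
  using has_derivative_cong_nhds[of f g x] has_derivative_cong_nhds[of g f x] assms
  by (auto simp: differentiable_def eq_commute)

text \<open>Every tensor below is computed from functions that agree with a chart expression only near
  the point, while the total function \<open>frechet_derivative\<close> is applied to the original one.\<close>

lemma fd_cong_nhds:
  assumes "eventually (\<lambda>z. f z = g z) (nhds x)"
  shows "fd f x = fd g x"
proof -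
  have "(f has_derivative f') (at x) \<longleftrightarrow> (g has_derivative f') (at x)" for f'
    using has_derivative_cong_nhds[of f g x] has_derivative_cong_nhds[of g f x] assms
    by (auto simp: eq_commute)
  then show ?thesis unfolding frechet_derivative_def by simp
qed

lemma fd_cong_open:
  assumes "open S" "x \<in> S" "\<And>z. z \<in> S \<Longrightarrow> f z = g z"
  shows "fd f x = fd g x"
  using assms by (intro fd_cong_nhds) (auto simp: eventually_nhds)

lemma Ck_on_cong:
  assumes "open S" "\<And>x. x \<in> S \<Longrightarrow> f x = g x"
  shows "Ck_on k S f \<longleftrightarrow> Ck_on k S g"
  using assms(2)
proof (induction k arbitrary: f g)
  case 0
  then show ?case by (simp cong: continuous_on_cong)
next
  case (Suc k)
  have "f differentiable (at x) \<longleftrightarrow> g differentiable (at x)" if "x \<in> S" for x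
    using that Suc.prems assms(1) by (intro differentiable_cong_nhds) (auto simp: eventually_nhds)
  moreover have "Ck_on k S (\<lambda>x. fd f x u) \<longleftrightarrow> Ck_on k S (\<lambda>x. fd g x u)" for u
    using Suc.prems by (intro Suc.IH) (metis fd_cong_open[OF assms(1)])
  ultimately show ?case by simp
qed

lemma Ck_on_transform:
  "Ck_on k S g \<Longrightarrow> open S \<Longrightarrow> (\<And>x. x \<in> S \<Longrightarrow> f x = g x) \<Longrightarrow> Ck_on k S f"
  using Ck_on_cong by blast

lemma Ck_on_subset: "Ck_on k S f \<Longrightarrow> T \<subseteq> S \<Longrightarrow> Ck_on k T f"
  by (induction k arbitrary: f) (auto intro: continuous_on_subset)

lemma Ck_on_Suc_imp: "Ck_on (Suc k) S f \<Longrightarrow> Ck_on k S f"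
proof (induction k arbitrary: f)
  case 0
  then show ?case
    by (auto intro!: continuous_at_imp_continuous_on differentiable_imp_continuous_within)
next
  case (Suc k)
  then show ?case by (metis Ck_on.simps(2))
qed

lemma Ck_on_const [simp]: "Ck_on k S (\<lambda>x. c)"
  by (induction k arbitrary: c) auto

lemma Ck_on_add:
  assumes "open S" "Ck_on k S f" "Ck_on k S g"
  shows "Ck_on k S (\<lambda>x. f x + g x)"
  using assms(2,3)
proof (induction k arbitrary: f g)
  case 0
  then show ?case by (simp add: continuous_on_add)
next
  case (Suc k)
  have d: "f differentiable (at x)" "g differentiable (at x)" if "x \<in> S" for x
    using Suc.prems that by auto
  have "fd (\<lambda>x. f x + g x) x u = fd f x u + fd g x u" if "x \<in> S" for x u
    using has_derivative_add[OF fd_works[OF d(1)[OF that]] fd_works[OF d(2)[OF that]]]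
    by (simp add: fd_eqI)
  moreover have "Ck_on k S (\<lambda>x. fd f x u + fd g x u)" for u
    using Suc.prems by (intro Suc.IH) auto
  ultimately have "Ck_on k S (\<lambda>x. fd (\<lambda>x. f x + g x) x u)" for u
    by - (rule Ck_on_transform[OF _ assms(1)], auto)
  then show ?case using d by (auto intro: differentiable_add)
qed

lemma Ck_on_sum:
  assumes "open S" "\<And>i. i \<in> I \<Longrightarrow> Ck_on k S (f i)"
  shows "Ck_on k S (\<lambda>x. \<Sum>i\<in>I. f i x)"
  using assms(2) by (induction I rule: infinite_finite_induct) (auto intro: Ck_on_add assms(1))

lemma Ck_on_scaleR:
  fixes f :: "'e::euclidean_space \<Rightarrow> real" and g :: "'e \<Rightarrow> 'f::real_normed_vector"
  assumes "open S" "Ck_on k S f" "Ck_on k S g"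
  shows "Ck_on k S (\<lambda>x. f x *\<^sub>R g x)"
  using assms(2,3)
proof (induction k arbitrary: f g)
  case 0
  then show ?case by (simp add: continuous_on_scaleR)
next
  case (Suc k)
  have d: "f differentiable (at x)" "g differentiable (at x)" if "x \<in> S" for x
    using Suc.prems that by auto
  have "fd (\<lambda>x. f x *\<^sub>R g x) x u = f x *\<^sub>R fd g x u + fd f x u *\<^sub>R g x" if "x \<in> S" for x u
    using has_derivative_scaleR[OF fd_works[OF d(1)[OF that]] fd_works[OF d(2)[OF that]]]
    by (simp add: fd_eqI)
  moreover have "Ck_on k S (\<lambda>x. f x *\<^sub>R fd g x u + fd f x u *\<^sub>R g x)" for u
    using Suc.prems Ck_on_Suc_imp[OF Suc.prems(1)] Ck_on_Suc_imp[OF Suc.prems(2)]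
    by (intro Ck_on_add[OF assms(1)] Suc.IH) auto
  ultimately have "Ck_on k S (\<lambda>x. fd (\<lambda>x. f x *\<^sub>R g x) x u)" for u
    by - (rule Ck_on_transform[OF _ assms(1)], auto)
  then show ?case using d by (auto intro: differentiable_scaleR)
qed

lemma Ck_on_linear:
  assumes "open S" "bounded_linear L" "Ck_on k S f"
  shows "Ck_on k S (\<lambda>x. L (f x))"
  using assms(3)
proof (induction k arbitrary: f)
  case 0
  then show ?case using assms(2) by (simp add: linear_continuous_on_compose bounded_linear.continuous_on)
next
  case (Suc k)
  have d: "((\<lambda>x. L (f x)) has_derivative (\<lambda>u. L (fd f x u))) (at x)" if "x \<in> S" for x
    using Suc.prems that by (auto intro!: bounded_linear.has_derivative[OF assms(2)] fd_works)
  have e: "fd (\<lambda>x. L (f x)) x u = L (fd f x u)" if "x \<in> S" for x u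
    using fd_eqI[OF d[OF that]] by simp
  have "Ck_on k S (\<lambda>x. L (fd f x u))" for u
    using Suc.prems by (intro Suc.IH) auto
  then have "Ck_on k S (\<lambda>x. fd (\<lambda>x. L (f x)) x u)" for u
    by (rule Ck_on_transform[OF _ assms(1) e])
  then show ?case using d by (auto simp: differentiable_def)
qed

text \<open>By the chain rule the derivative of \<open>g \<circ> f\<close> is a sum of products of derivatives of \<open>f\<close> with
  functions \<open>fd g (f x) i\<close>, which are again composites of the same form, one order lower.\<close>

lemma Ck_on_compose:
  fixes f :: "'e::euclidean_space \<Rightarrow> 'g::euclidean_space" and g :: "'g \<Rightarrow> 'f::real_normed_vector"
  assumes "open S" "open T" "\<And>x. x \<in> S \<Longrightarrow> f x \<in> T" "Ck_on k S f" "Ck_on k T g"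
  shows "Ck_on k S (\<lambda>x. g (f x))"
  using assms(4,5)
proof (induction k arbitrary: g)
  case 0
  then show ?case using assms(3) by (auto intro: continuous_on_compose2)
next
  case (Suc k)
  have df: "f differentiable (at x)" and dg: "g differentiable (at (f x))" if "x \<in> S" for x
    using Suc.prems assms(3) that by auto
  have d: "((\<lambda>x. g (f x)) has_derivative (\<lambda>u. fd g (f x) (fd f x u))) (at x)" if "x \<in> S" for x
    using diff_chain_at[OF fd_works[OF df[OF that]] fd_works[OF dg[OF that]]] by (simp add: o_def)
  have e: "fd (\<lambda>x. g (f x)) x u = (\<Sum>i\<in>Basis. (fd f x u \<bullet> i) *\<^sub>R fd g (f x) i)"
    if "x \<in> S" for x u
    using linear_basis_sum[OF fd_linear[OF dg[OF that]], of "fd f x u"]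
    by (simp add: fd_eqI[OF d[OF that]])
  have "Ck_on k S (\<lambda>x. \<Sum>i\<in>Basis. (fd f x u \<bullet> i) *\<^sub>R fd g (f x) i)" for u
  proof (rule Ck_on_sum[OF assms(1)], rule Ck_on_scaleR[OF assms(1)])
    fix i :: 'g
    show "Ck_on k S (\<lambda>x. fd f x u \<bullet> i)"
      using Suc.prems by (intro Ck_on_linear[OF assms(1) bounded_linear_inner_left]) auto
    show "Ck_on k S (\<lambda>x. fd g (f x) i)"
      using Suc.prems(2) by (intro Suc.IH Ck_on_Suc_imp[OF Suc.prems(1)]) auto
  qed
  then have "Ck_on k S (\<lambda>x. fd (\<lambda>x. g (f x)) x u)" for u
    by (rule Ck_on_transform[OF _ assms(1) e])
  then show ?case using d by (auto simp: differentiable_def)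
qed

lemma Ck_on_id [simp]: "Ck_on k S (\<lambda>x. x)"
  by (cases k) auto

lemma smooth_on_cong:
  "open S \<Longrightarrow> (\<And>x. x \<in> S \<Longrightarrow> f x = g x) \<Longrightarrow> smooth_on S f \<longleftrightarrow> smooth_on S g"
  unfolding smooth_on_def using Ck_on_cong by blast

lemma smooth_on_transform:
  "smooth_on S g \<Longrightarrow> open S \<Longrightarrow> (\<And>x. x \<in> S \<Longrightarrow> f x = g x) \<Longrightarrow> smooth_on S f"
  using smooth_on_cong by blast

lemma smooth_on_subset: "smooth_on S f \<Longrightarrow> T \<subseteq> S \<Longrightarrow> smooth_on T f"
  unfolding smooth_on_def using Ck_on_subset by blast

lemma smooth_on_const [simp]: "smooth_on S (\<lambda>x. c)" by (simp add: smooth_on_def)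

lemma smooth_on_id [simp]: "smooth_on S (\<lambda>x. x)" by (simp add: smooth_on_def)

lemma smooth_on_add:
  "open S \<Longrightarrow> smooth_on S f \<Longrightarrow> smooth_on S g \<Longrightarrow> smooth_on S (\<lambda>x. f x + g x)"
  by (simp add: smooth_on_def Ck_on_add)

lemma smooth_on_sum:
  "open S \<Longrightarrow> (\<And>i. i \<in> I \<Longrightarrow> smooth_on S (f i)) \<Longrightarrow> smooth_on S (\<lambda>x. \<Sum>i\<in>I. f i x)"
  by (simp add: smooth_on_def Ck_on_sum)

lemma smooth_on_scaleR:
  fixes f :: "'e::euclidean_space \<Rightarrow> real"
  shows "open S \<Longrightarrow> smooth_on S f \<Longrightarrow> smooth_on S g \<Longrightarrow> smooth_on S (\<lambda>x. f x *\<^sub>R g x)"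
  by (simp add: smooth_on_def Ck_on_scaleR)

lemma smooth_on_linear:
  "open S \<Longrightarrow> bounded_linear L \<Longrightarrow> smooth_on S f \<Longrightarrow> smooth_on S (\<lambda>x. L (f x))"
  by (simp add: smooth_on_def Ck_on_linear)

lemma smooth_on_diff:
  "open S \<Longrightarrow> smooth_on S f \<Longrightarrow> smooth_on S g \<Longrightarrow> smooth_on S (\<lambda>x. f x - g x)"
  using smooth_on_add[of S f "\<lambda>x. - g x"]
    smooth_on_linear[OF _ bounded_linear_minus[OF bounded_linear_ident], of S g] by simp

lemma smooth_on_compose:
  fixes f :: "'e::euclidean_space \<Rightarrow> 'g::euclidean_space"
  shows "open S \<Longrightarrow> open T \<Longrightarrow> (\<And>x. x \<in> S \<Longrightarrow> f x \<in> T) \<Longrightarrow> smooth_on S f \<Longrightarrow> smooth_on T g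
    \<Longrightarrow> smooth_on S (\<lambda>x. g (f x))"
  by (simp add: smooth_on_def Ck_on_compose)

lemma smooth_on_differentiable: "smooth_on S f \<Longrightarrow> x \<in> S \<Longrightarrow> f differentiable (at x)"
  unfolding smooth_on_def by (metis Ck_on.simps(2))

lemma smooth_on_fd: "smooth_on S f \<Longrightarrow> smooth_on S (\<lambda>x. fd f x u)"
  unfolding smooth_on_def by (metis Ck_on.simps(2))

lemma smooth_on_bilinear_apply:
  fixes L :: "'e::euclidean_space \<Rightarrow> 'g::euclidean_space \<Rightarrow> 'f::real_normed_vector"
  assumes "open S" "\<And>x. x \<in> S \<Longrightarrow> linear (L x)" "\<And>u. smooth_on S (\<lambda>x. L x u)" "smooth_on S g"
  shows "smooth_on S (\<lambda>x. L x (g x))"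
proof -
  have "smooth_on S (\<lambda>x. (g x \<bullet> i) *\<^sub>R L x i)" for i
    by (rule smooth_on_scaleR[OF assms(1) smooth_on_linear[OF assms(1) bounded_linear_inner_left
            assms(4)] assms(3)])
  then have "smooth_on S (\<lambda>x. \<Sum>i\<in>Basis. (g x \<bullet> i) *\<^sub>R L x i)"
    by (rule smooth_on_sum[OF assms(1)])
  then show ?thesis
    by (rule smooth_on_transform[OF _ assms(1) linear_basis_sum[OF assms(2)]])
qed

lemma smooth_on_fd_apply:
  fixes f :: "'e::euclidean_space \<Rightarrow> 'f::real_normed_vector"
  assumes "open S" "smooth_on S f" "smooth_on S g"
  shows "smooth_on S (\<lambda>x. fd f x (g x))"
  by (rule smooth_on_bilinear_apply[OF assms(1) fd_linear smooth_on_fd[OF assms(2)] assms(3)])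
    (rule smooth_on_differentiable[OF assms(2)])

lemma smooth_on_Pair:
  fixes f :: "'e::euclidean_space \<Rightarrow> 'f::real_normed_vector" and g :: "'e \<Rightarrow> 'g::real_normed_vector"
  assumes "open S" "smooth_on S f" "smooth_on S g"
  shows "smooth_on S (\<lambda>x. (f x, g x))"
proof -
  have "bounded_linear (\<lambda>v::'f. (v, 0::'g))" "bounded_linear (\<lambda>v::'g. (0::'f, v))"
    by (intro bounded_linear_Pair bounded_linear_ident bounded_linear_zero)+
  from smooth_on_add[OF assms(1) smooth_on_linear[OF assms(1) this(1) assms(2)]
      smooth_on_linear[OF assms(1) this(2) assms(3)]]
  have "smooth_on S (\<lambda>x. (f x, 0) + (0, g x))" .
  then show ?thesis by simp
qed

section \<open>Second derivatives\<close>

text \<open>Here \<open>v\<close> is the direction of the inner derivative and \<open>u\<close> that of the outer one.\<close>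

definition D2 :: "('e::euclidean_space \<Rightarrow> real) \<Rightarrow> 'e \<Rightarrow> 'e \<Rightarrow> 'e \<Rightarrow> real" where
  "D2 f x u v = fd (\<lambda>z. fd f z v) x u"

lemma Ck_on_2D:
  assumes "Ck_on 2 S f" "x \<in> S"
  shows "f differentiable (at x)" "(\<lambda>z. fd f z v) differentiable (at x)"
    "continuous_on S (\<lambda>x. fd (\<lambda>z. fd f z v) x u)"
  using assms by (auto simp: numeral_2_eq_2)

text \<open>The product rule for a derivative taken along a moving direction. Lie brackets, exterior
  derivatives and the differentiated Euler identity are all instances of it.\<close>

lemma has_derivative_fd_apply:
  fixes f :: "'e::euclidean_space \<Rightarrow> real"
  assumes S: "open S" "x \<in> S" and f: "Ck_on 2 S f" and Y: "(Y has_derivative Y') (at x)"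
  shows "((\<lambda>z. fd f z (Y z)) has_derivative (\<lambda>h. D2 f x h (Y x) + fd f x (Y' h))) (at x)"
proof -
  have lin: "linear (fd f z)" if "z \<in> S" for z using Ck_on_2D(1)[OF f that] by (rule fd_linear)
  have D: "((\<lambda>z. fd f z v) has_derivative (\<lambda>h. D2 f x h v)) (at x)" for v
    unfolding D2_def by (rule fd_works[OF Ck_on_2D(2)[OF f S(2)]])
  have "((\<lambda>z. \<Sum>i\<in>Basis. (Y z \<bullet> i) *\<^sub>R fd f z i) has_derivative
      (\<lambda>h. \<Sum>i\<in>Basis. (Y x \<bullet> i) *\<^sub>R D2 f x h i + (Y' h \<bullet> i) *\<^sub>R fd f x i)) (at x)"
    by (intro has_derivative_sum has_derivative_scaleR has_derivative_inner_left Y D)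
  then have Dsum: "((\<lambda>z. fd f z (Y z)) has_derivative
      (\<lambda>h. \<Sum>i\<in>Basis. (Y x \<bullet> i) *\<^sub>R D2 f x h i + (Y' h \<bullet> i) *\<^sub>R fd f x i)) (at x)"
    by (rule has_derivative_transform_within_open[OF _ S])
      (rule linear_basis_sum[OF lin, symmetric])
  have "((\<lambda>z. \<Sum>i\<in>Basis. (Y x \<bullet> i) *\<^sub>R fd f z i) has_derivative
      (\<lambda>h. \<Sum>i\<in>Basis. (Y x \<bullet> i) *\<^sub>R D2 f x h i)) (at x)"
    by (intro has_derivative_sum has_derivative_scaleR_right D)
  then have "((\<lambda>z. fd f z (Y x)) has_derivative
      (\<lambda>h. \<Sum>i\<in>Basis. (Y x \<bullet> i) *\<^sub>R D2 f x h i)) (at x)"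
    by (rule has_derivative_transform_within_open[OF _ S])
      (rule linear_basis_sum[OF lin, symmetric])
  then have "D2 f x h (Y x) = (\<Sum>i\<in>Basis. (Y x \<bullet> i) *\<^sub>R D2 f x h i)" for h
    using fun_cong[OF fd_eqI, of _ _ x h] by (simp add: D2_def)
  then show ?thesis
    using Dsum unfolding linear_basis_sum[OF lin[OF S(2)], of "Y' _"] by (simp only: sum.distrib)
qed

lemma D2_linear_left:
  assumes "x \<in> S" "Ck_on 2 S f" shows "linear (\<lambda>u. D2 f x u v)"
  unfolding D2_def by (rule fd_linear[OF Ck_on_2D(2)[OF assms(2,1)]])

lemma has_derivative_line:
  fixes f :: "'e::euclidean_space \<Rightarrow> real"
  assumes "f differentiable (at (c + s *\<^sub>R u))"
  shows "((\<lambda>s. f (c + s *\<^sub>R u)) has_real_derivative fd f (c + s *\<^sub>R u) u) (at s)"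
proof -
  have "((\<lambda>s. c + s *\<^sub>R u) has_derivative (\<lambda>h. h *\<^sub>R u)) (at s)"
    by (auto intro!: derivative_eq_intros)
  then have "((\<lambda>s. f (c + s *\<^sub>R u)) has_derivative (\<lambda>h. fd f (c + s *\<^sub>R u) (h *\<^sub>R u))) (at s)"
    using fd_works[OF assms]
    by (rule has_derivative_compose[where g = f and f = "\<lambda>s. c + s *\<^sub>R u"])
  then show ?thesis
    using linear_scale[OF fd_linear[OF assms]]
    by (simp add: has_field_derivative_def mult.commute[of _ "fd f _ u"])
qed

text \<open>Two applications of the mean value theorem, first in the direction \<open>u\<close> and then in the
  direction \<open>v\<close>. The left-hand side is symmetric in \<open>u\<close> and \<open>v\<close>, and the right-hand side tends to a
  mixed second derivative after division by \<open>t\<^sup>2\<close>: hence the symmetry proved next.\<close>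

lemma second_difference_mean_value:
  fixes f :: "'e::euclidean_space \<Rightarrow> real"
  assumes f: "Ck_on 2 S f" and ball: "ball x \<delta> \<subseteq> S"
    and t: "0 < t" "t * (norm u + norm v) < \<delta>"
  obtains z where "z \<in> ball x \<delta>"
    "f (x + t *\<^sub>R u + t *\<^sub>R v) - f (x + t *\<^sub>R u) - f (x + t *\<^sub>R v) + f x = t * t * D2 f z v u"
proof -
  have mem: "x + r *\<^sub>R u + s *\<^sub>R v \<in> ball x \<delta>" if "0 \<le> r" "r \<le> t" "0 \<le> s" "s \<le> t" for r s
  proof -
    have "norm (r *\<^sub>R u + s *\<^sub>R v) \<le> r * norm u + s * norm v"
      using norm_triangle_ineq[of "r *\<^sub>R u" "s *\<^sub>R v"] that by simp
    also have "\<dots> \<le> t * norm u + t * norm v"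
      using that by (intro add_mono mult_right_mono) auto
    also have "\<dots> < \<delta>" using t by (simp add: distrib_left)
    finally show ?thesis
      using norm_minus_cancel[of "r *\<^sub>R u + s *\<^sub>R v"] by (simp add: dist_norm)
  qed
  define \<phi> where "\<phi> = (\<lambda>r. f (x + t *\<^sub>R v + r *\<^sub>R u) - f (x + r *\<^sub>R u))"
  have "\<exists>r>0. r < t \<and> \<phi> t - \<phi> 0 = (t - 0) * (fd f (x + t *\<^sub>R v + r *\<^sub>R u) u - fd f (x + r *\<^sub>R u) u)"
  proof (rule MVT2[OF t(1)])
    fix r assume r: "0 \<le> r" "r \<le> t"
    have "x + t *\<^sub>R v + r *\<^sub>R u \<in> S" "x + r *\<^sub>R u \<in> S"
      using mem[OF r, of t] mem[OF r, of 0] t ball by (auto simp: algebra_simps)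
    then show "(\<phi> has_real_derivative
        fd f (x + t *\<^sub>R v + r *\<^sub>R u) u - fd f (x + r *\<^sub>R u) u) (at r)"
      unfolding \<phi>_def using f by (intro DERIV_diff has_derivative_line) (auto intro: Ck_on_2D)
  qed
  then obtain r where r: "0 < r" "r < t"
    and e1: "\<phi> t - \<phi> 0 = t * (fd f (x + t *\<^sub>R v + r *\<^sub>R u) u - fd f (x + r *\<^sub>R u) u)" by auto
  define \<psi> where "\<psi> = (\<lambda>s. fd f (x + r *\<^sub>R u + s *\<^sub>R v) u)"
  have "\<exists>s>0. s < t \<and> \<psi> t - \<psi> 0 = (t - 0) * D2 f (x + r *\<^sub>R u + s *\<^sub>R v) v u"
  proof (rule MVT2[OF t(1)])
    fix s assume s: "0 \<le> s" "s \<le> t"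
    have "x + r *\<^sub>R u + s *\<^sub>R v \<in> S" using mem[of r s] r s ball by auto
    then show "(\<psi> has_real_derivative D2 f (x + r *\<^sub>R u + s *\<^sub>R v) v u) (at s)"
      unfolding \<psi>_def D2_def using f by (intro has_derivative_line) (auto intro: Ck_on_2D)
  qed
  then obtain s where s: "0 < s" "s < t"
    and e2: "\<psi> t - \<psi> 0 = t * D2 f (x + r *\<^sub>R u + s *\<^sub>R v) v u" by auto
  have "\<phi> t - \<phi> 0 = t * (\<psi> t - \<psi> 0)" using e1 by (simp add: \<psi>_def algebra_simps)
  then have "\<phi> t - \<phi> 0 = t * t * D2 f (x + r *\<^sub>R u + s *\<^sub>R v) v u" using e2 by simp
  then show ?thesis
    using that[of "x + r *\<^sub>R u + s *\<^sub>R v"] mem[of r s] r s by (simp add: \<phi>_def algebra_simps)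
qed

lemma D2_symmetric:
  fixes f :: "'e::euclidean_space \<Rightarrow> real"
  assumes S: "open S" "x \<in> S" and f: "Ck_on 2 S f"
  shows "D2 f x u v = D2 f x v u"
proof (rule ccontr)
  assume ne: "D2 f x u v \<noteq> D2 f x v u"
  define \<epsilon> where "\<epsilon> = \<bar>D2 f x u v - D2 f x v u\<bar> / 2"
  have \<epsilon>: "\<epsilon> > 0" using ne by (simp add: \<epsilon>_def)
  have "\<exists>d>0. \<forall>z. dist z x < d \<longrightarrow> dist (D2 f z a b) (D2 f x a b) < \<epsilon>" for a b
  proof -
    have "isCont (\<lambda>z. D2 f z a b) x"
      using Ck_on_2D(3)[OF f S(2)] S by (simp add: continuous_on_eq_continuous_at D2_def)
    then show ?thesis using \<epsilon> by (simp add: continuous_at_eps_delta)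
  qed
  then obtain d1 d2 where d: "d1 > 0" "d2 > 0"
    "\<And>z. dist z x < d1 \<Longrightarrow> dist (D2 f z u v) (D2 f x u v) < \<epsilon>"
    "\<And>z. dist z x < d2 \<Longrightarrow> dist (D2 f z v u) (D2 f x v u) < \<epsilon>" by metis
  obtain d3 where d3: "d3 > 0" "ball x d3 \<subseteq> S" using S open_contains_ball by blast
  define \<delta> where "\<delta> = min d1 (min d2 d3)"
  have \<delta>: "\<delta> > 0" "ball x \<delta> \<subseteq> S" using d d3 by (auto simp: \<delta>_def)
  define t where "t = \<delta> / (norm u + norm v + 1)"
  have np: "norm u + norm v + 1 > 0" by (simp add: add_nonneg_pos)
  then have t: "t > 0" "t * (norm u + norm v) < \<delta>" "t * (norm v + norm u) < \<delta>"
    using \<delta> by (auto simp: t_def field_simps)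
  obtain z1 where z1: "z1 \<in> ball x \<delta>" and
    e1: "f (x + t *\<^sub>R u + t *\<^sub>R v) - f (x + t *\<^sub>R u) - f (x + t *\<^sub>R v) + f x = t * t * D2 f z1 v u"
    using second_difference_mean_value[OF f \<delta>(2) t(1,2)] .
  obtain z2 where z2: "z2 \<in> ball x \<delta>" and
    e2: "f (x + t *\<^sub>R v + t *\<^sub>R u) - f (x + t *\<^sub>R v) - f (x + t *\<^sub>R u) + f x = t * t * D2 f z2 u v"
    using second_difference_mean_value[OF f \<delta>(2) t(1,3)] .
  have "t * t * D2 f z1 v u = t * t * D2 f z2 u v"
    unfolding e1[symmetric] e2[symmetric] by (simp add: algebra_simps)
  then have "D2 f z1 v u = D2 f z2 u v" using t(1) by simp
  moreover have "dist (D2 f z1 v u) (D2 f x v u) < \<epsilon>" "dist (D2 f z2 u v) (D2 f x u v) < \<epsilon>"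
    using d(3)[of z2] d(4)[of z1] z1 z2 by (auto simp: \<delta>_def dist_commute[of x])
  ultimately show False unfolding \<epsilon>_def dist_real_def by (auto simp: abs_if split: if_splits)
qed

lemma D2_linear_right:
  assumes "open S" "x \<in> S" "Ck_on 2 S f" shows "linear (D2 f x u)"
  using D2_linear_left[OF assms(2,3), of u] by (subst D2_symmetric[OF assms, abs_def])

section \<open>Linear systems depending on a parameter\<close>

text \<open>The sharp of a 1-form solves a linear system whose coefficients vary with the point. Its
  smoothness is obtained without determinants: the solution is continuous because an injective
  linear map is bounded below, it is differentiable because it satisfies a fixed-point equation at
  each point, and its derivatives solve systems with the same coefficient maps, so that induction
  on the order applies.\<close>

lemma continuous_on_linear_solution:
  fixes T :: "'e::euclidean_space \<Rightarrow> 'f::euclidean_space \<Rightarrow> 'f"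
  assumes S: "open S" and lin: "\<And>x. x \<in> S \<Longrightarrow> linear (T x)" and inj: "\<And>x. x \<in> S \<Longrightarrow> inj (T x)"
    and T: "\<And>v. continuous_on S (\<lambda>x. T x v)" and b: "continuous_on S b"
    and w: "\<And>x. x \<in> S \<Longrightarrow> T x (w x) = b x"
  shows "continuous_on S w"
proof (intro continuous_at_imp_continuous_on ballI)
  fix x assume x: "x \<in> S"
  obtain m where m: "m > 0" "\<And>v. m * norm v \<le> norm (T x v)"
    using linear_inj_bounded_below_pos[OF lin[OF x] inj[OF x]] by (metis mult.commute)
  define \<theta> where "\<theta> = (\<lambda>z. \<Sum>i\<in>Basis. norm (T z i - T x i))"
  have isC: "isCont (\<lambda>z. T z v) x" "isCont b x" for v
    using T b S x continuous_on_eq_continuous_at by blast+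
  have TD: "norm (T z v - T x v) \<le> \<theta> z * norm v" if "z \<in> S" for z v
  proof -
    have "T z v - T x v = (\<Sum>i\<in>Basis. (v \<bullet> i) *\<^sub>R (T z i - T x i))"
      unfolding linear_basis_sum[OF lin[OF that], of v] linear_basis_sum[OF lin[OF x], of v]
      by (simp add: sum_subtractf scaleR_diff_right)
    also have "norm \<dots> \<le> (\<Sum>i\<in>Basis. norm (T z i - T x i) * norm v)"
      by (intro sum_norm_le) (simp add: mult.commute[of _ "norm v"] Basis_le_norm mult_right_mono)
    finally show ?thesis by (simp add: \<theta>_def sum_distrib_right)
  qed
  have \<theta>0: "(\<theta> \<longlongrightarrow> 0) (at x)"
  proof -
    have "isCont \<theta> x" unfolding \<theta>_def by (intro continuous_intros isC)
    moreover have "\<theta> x = 0" by (simp add: \<theta>_def)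
    ultimately show ?thesis by (simp add: continuous_at)
  qed
  have bound: "\<forall>\<^sub>F z in at x. norm (w z - w x) \<le> (2 / m) * norm (b z - T z (w x))"
  proof -
    have "\<forall>\<^sub>F z in at x. \<theta> z < m / 2"
      using \<theta>0 m(1) by (intro order_tendstoD) auto
    moreover have "\<forall>\<^sub>F z in at x. z \<in> S" using S x by (rule eventually_at_in_open')
    ultimately show ?thesis
    proof eventually_elim
      case (elim z)
      define v where "v = w z - w x"
      have "T z v = b z - T z (w x)" using w[OF elim(2)] linear_diff[OF lin[OF elim(2)]]
        by (simp add: v_def)
      have "m * norm v \<le> norm (T x v)" by (rule m)
      also have "\<dots> \<le> norm (T z v) + norm (T z v - T x v)"
        using norm_triangle_ineq[of "T z v" "T x v - T z v"] by (simp add: norm_minus_commute)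
      also have "\<dots> \<le> norm (T z v) + (m / 2) * norm v"
        using TD[OF elim(2), of v] mult_right_mono[OF less_imp_le[OF elim(1)], of "norm v"] by simp
      finally have "(m / 2) * norm v \<le> norm (T z v)" by simp
      then show ?case
        unfolding \<open>T z v = _\<close>[symmetric] using m(1) by (simp add: v_def field_simps)
    qed
  qed
  have "isCont (\<lambda>z. (2 / m) * norm (b z - T z (w x))) x"
    by (intro continuous_intros isC)
  then have "((\<lambda>z. (2 / m) * norm (b z - T z (w x))) \<longlongrightarrow> 0) (at x)"
    by (simp add: continuous_at w[OF x])
  from Lim_null_comparison[OF bound this] show "isCont w x"
    unfolding continuous_at using LIM_zero_iff by blast
qed

text \<open>The derivative of \<open>g\<close> would be multiplied by \<open>f x = 0\<close>, so continuity suffices; this is what lets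
  differentiability of a solution be deduced from its continuity.\<close>

lemma has_derivative_vanishing_scaleR:
  fixes f :: "'e::real_normed_vector \<Rightarrow> 'f::real_normed_vector" and g :: "'e \<Rightarrow> real"
  assumes f: "(f has_derivative f') (at x)" "f x = 0" and g: "isCont g x"
  shows "((\<lambda>z. g z *\<^sub>R f z) has_derivative (\<lambda>h. g x *\<^sub>R f' h)) (at x)"
proof -
  interpret f': bounded_linear f' using f(1) by (rule has_derivative_bounded_linear)
  obtain B where B: "B > 0" "\<And>h. norm (f' h) \<le> norm h * B" using f'.pos_bounded by blast
  have bl: "bounded_linear (\<lambda>h. g x *\<^sub>R f' h)"
    by (intro bounded_linear_const_scaleR f'.bounded_linear_axioms)
  let ?r = "\<lambda>y. norm (f y - f x - f' (y - x)) / norm (y - x)"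
  have r: "(?r \<longlongrightarrow> 0) (at x)"
    using f(1) by (simp add: has_derivative_iff_norm)
  have gx: "(g \<longlongrightarrow> g x) (at x)" using g by (simp add: continuous_at)
  have "((\<lambda>y. \<bar>g y\<bar> * ?r y + \<bar>g y - g x\<bar> * B) \<longlongrightarrow> \<bar>g x\<bar> * 0 + \<bar>g x - g x\<bar> * B) (at x)"
    by (intro tendsto_intros gx r)
  then have lim: "((\<lambda>y. \<bar>g y\<bar> * ?r y + \<bar>g y - g x\<bar> * B) \<longlongrightarrow> 0) (at x)" by simp
  have "\<forall>\<^sub>F y in at x. norm (norm (g y *\<^sub>R f y - g x *\<^sub>R f x - g x *\<^sub>R f' (y - x)) / norm (y - x))
      \<le> \<bar>g y\<bar> * ?r y + \<bar>g y - g x\<bar> * B"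
  proof (rule eventually_mono[OF eventually_neq_at_within[of x]])
    fix y assume y: "y \<noteq> x"
    have "g y *\<^sub>R f y - g x *\<^sub>R f x - g x *\<^sub>R f' (y - x)
        = g y *\<^sub>R (f y - f x - f' (y - x)) + (g y - g x) *\<^sub>R f' (y - x)"
      using f(2) by (simp add: algebra_simps)
    then have "norm (g y *\<^sub>R f y - g x *\<^sub>R f x - g x *\<^sub>R f' (y - x))
        \<le> \<bar>g y\<bar> * norm (f y - f x - f' (y - x)) + \<bar>g y - g x\<bar> * norm (f' (y - x))"
      by (metis norm_scaleR norm_triangle_ineq)
    also have "\<dots> \<le> \<bar>g y\<bar> * norm (f y - f x - f' (y - x)) + \<bar>g y - g x\<bar> * (norm (y - x) * B)"
      by (intro add_left_mono mult_left_mono B) auto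
    finally show "norm (norm (g y *\<^sub>R f y - g x *\<^sub>R f x - g x *\<^sub>R f' (y - x)) / norm (y - x))
      \<le> \<bar>g y\<bar> * ?r y + \<bar>g y - g x\<bar> * B"
      using y by (simp add: field_simps)
  qed
  from Lim_null_comparison[OF this lim] show ?thesis
    using bl by (simp add: has_derivative_iff_norm)
qed

lemma differentiable_linear_solution:
  fixes T :: "'e::euclidean_space \<Rightarrow> 'f::euclidean_space \<Rightarrow> 'f"
  assumes S: "open S" and x: "x \<in> S"
    and lin: "\<And>x. x \<in> S \<Longrightarrow> linear (T x)" and inj: "\<And>x. x \<in> S \<Longrightarrow> inj (T x)"
    and T: "\<And>v x. x \<in> S \<Longrightarrow> (\<lambda>x. T x v) differentiable (at x)"
    and b: "\<And>x. x \<in> S \<Longrightarrow> b differentiable (at x)"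
    and w: "\<And>x. x \<in> S \<Longrightarrow> T x (w x) = b x"
  shows "w differentiable (at x)"
proof -
  have cont: "continuous_on S f" if "\<And>x. x \<in> S \<Longrightarrow> f differentiable (at x)"
    for f :: "'e \<Rightarrow> 'f"
    using that by (intro continuous_at_imp_continuous_on ballI differentiable_imp_continuous_within)
  have "continuous_on S w"
    by (rule continuous_on_linear_solution[OF S lin inj cont[OF T] cont[OF b] w])
  then have wc: "isCont w x" using S x continuous_on_eq_continuous_at by blast
  obtain I where I: "linear I" "I \<circ> T x = id"
    using linear_injective_left_inverse[OF lin[OF x] inj[OF x]] by blast
  have bI: "bounded_linear I" using I(1) by (simp add: linear_conv_bounded_linear)
  \<comment> \<open>With a left inverse I of T x, the solution satisfies w = I (b - (T - T x) w), where the
    coefficients of T - T x vanish at x.\<close>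
  have "(\<lambda>z. (w z \<bullet> i) *\<^sub>R (T z i - T x i)) differentiable (at x)" for i
  proof -
    have "((\<lambda>z. T z i - T x i) has_derivative fd (\<lambda>z. T z i) x) (at x)"
      using has_derivative_diff[OF fd_works[OF T[OF x, of i]] has_derivative_const] by simp
    from has_derivative_vanishing_scaleR[OF this, of "\<lambda>z. w z \<bullet> i"] wc show ?thesis
      by (auto simp: differentiable_def intro: continuous_intros)
  qed
  then have "(\<lambda>z. b z - (\<Sum>i\<in>Basis. (w z \<bullet> i) *\<^sub>R (T z i - T x i))) differentiable (at x)"
    by (intro differentiable_diff differentiable_sum b[OF x]) auto
  then have "(\<lambda>z. I (b z - (\<Sum>i\<in>Basis. (w z \<bullet> i) *\<^sub>R (T z i - T x i)))) differentiable (at x)"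
    using bounded_linear.has_derivative[OF bI] unfolding differentiable_def by blast
  moreover have "I (b z - (\<Sum>i\<in>Basis. (w z \<bullet> i) *\<^sub>R (T z i - T x i))) = w z" if "z \<in> S" for z
  proof -
    have "(\<Sum>i\<in>Basis. (w z \<bullet> i) *\<^sub>R (T z i - T x i)) = T z (w z) - T x (w z)"
      unfolding linear_basis_sum[OF lin[OF that], of "w z"] linear_basis_sum[OF lin[OF x], of "w z"]
      by (simp add: sum_subtractf scaleR_diff_right)
    then show ?thesis using w[OF that] I(2) by (simp add: fun_eq_iff)
  qed
  ultimately show ?thesis
    using S x by (subst differentiable_cong_nhds[where g =
      "\<lambda>z. I (b z - (\<Sum>i\<in>Basis. (w z \<bullet> i) *\<^sub>R (T z i - T x i)))"]) (auto simp: eventually_nhds)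
qed

lemma Ck_on_linear_solution:
  fixes T :: "'e::euclidean_space \<Rightarrow> 'f::euclidean_space \<Rightarrow> 'f"
  assumes S: "open S"
    and lin: "\<And>x. x \<in> S \<Longrightarrow> linear (T x)" and inj: "\<And>x. x \<in> S \<Longrightarrow> inj (T x)"
    and T: "\<And>v. Ck_on k S (\<lambda>x. T x v)" and b: "Ck_on k S b"
    and w: "\<And>x. x \<in> S \<Longrightarrow> T x (w x) = b x"
  shows "Ck_on k S w"
  using T b w
proof (induction k arbitrary: b w)
  case 0
  then show ?case
    using continuous_on_linear_solution[OF S lin inj, where b = b and w = w] by simp
next
  case (Suc k)
  have T': "(\<lambda>z. T z v) differentiable (at x)" if "x \<in> S" for x v
    using Suc.prems(1)[of v] that by simp
  have d: "w differentiable (at x)" if "x \<in> S" for x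
    using differentiable_linear_solution[OF S that lin inj T', where b = b and w = w] Suc.prems(2,3) by simp
  have Tk: "Ck_on k S (\<lambda>x. T x v)" for v by (rule Ck_on_Suc_imp[OF Suc.prems(1)])
  have wk: "Ck_on k S w"
    by (rule Suc.IH[OF Tk Ck_on_Suc_imp[OF Suc.prems(2)] Suc.prems(3)])
  let ?b = "\<lambda>u x. fd b x u - (\<Sum>i\<in>Basis. (w x \<bullet> i) *\<^sub>R fd (\<lambda>z. T z i) x u)"
  \<comment> \<open>Differentiating T w = b shows that the derivative of w solves a system of the same kind.\<close>
  have eq: "T x (fd w x u) = ?b u x" if x: "x \<in> S" for x u
  proof -
    have "((\<lambda>z. \<Sum>i\<in>Basis. (w z \<bullet> i) *\<^sub>R T z i) has_derivative
       (\<lambda>h. \<Sum>i\<in>Basis. (w x \<bullet> i) *\<^sub>R fd (\<lambda>z. T z i) x h + (fd w x h \<bullet> i) *\<^sub>R T x i)) (at x)"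
      by (intro has_derivative_sum has_derivative_scaleR has_derivative_inner_left fd_works d T' x)
    then have "(b has_derivative
       (\<lambda>h. \<Sum>i\<in>Basis. (w x \<bullet> i) *\<^sub>R fd (\<lambda>z. T z i) x h + (fd w x h \<bullet> i) *\<^sub>R T x i)) (at x)"
      by (rule has_derivative_transform_within_open[OF _ S x])
        (simp add: linear_basis_sum[OF lin, symmetric] Suc.prems)
    from fd_eqI[OF this] show ?thesis
      by (simp add: linear_basis_sum[OF lin[OF x], of "fd w x u"] sum.distrib)
  qed
  show ?case
    unfolding Ck_on.simps
  proof (intro conjI ballI allI d)
    fix u
    have neg: "Ck_on k S (\<lambda>x. - f x)" if "Ck_on k S f" for f :: "'e \<Rightarrow> 'f"
      by (rule Ck_on_linear[OF S bounded_linear_minus[OF bounded_linear_ident] that])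
    have "Ck_on k S (\<lambda>x. fd b x u + - (\<Sum>i\<in>Basis. (w x \<bullet> i) *\<^sub>R fd (\<lambda>z. T z i) x u))"
      using Suc.prems(1,2) by (intro Ck_on_add[OF S] neg Ck_on_sum[OF S] Ck_on_scaleR[OF S]
          Ck_on_linear[OF S bounded_linear_inner_left wk]) auto
    then have "Ck_on k S (?b u)" by simp
    from Suc.IH[OF Tk this eq] show "Ck_on k S (\<lambda>x. fd w x u)" .
  qed
qed

lemma smooth_on_linear_solution:
  fixes T :: "'e::euclidean_space \<Rightarrow> 'f::euclidean_space \<Rightarrow> 'f"
  assumes "open S" "\<And>x. x \<in> S \<Longrightarrow> linear (T x)" "\<And>x. x \<in> S \<Longrightarrow> inj (T x)"
    and "\<And>v. smooth_on S (\<lambda>x. T x v)" "smooth_on S b" "\<And>x. x \<in> S \<Longrightarrow> T x (w x) = b x"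
  shows "smooth_on S w"
  using Ck_on_linear_solution[OF assms(1-3), where b = b and w = w] assms(4-6) by (simp add: smooth_on_def)

section \<open>Vector fields in a chart\<close>

locale atlas =
  fixes A :: "('a, 'e::euclidean_space) chart set"
  assumes smooth_atlas: "smooth_atlas A"
begin

lemma open_overlap: "c \<in> A \<Longrightarrow> d \<in> A \<Longrightarrow> open (snd c ` (fst c \<inter> fst d))"
  using smooth_atlas unfolding smooth_atlas_def by blast

lemma open_chart: "c \<in> A \<Longrightarrow> open (snd c ` fst c)"
  using smooth_atlas unfolding smooth_atlas_def by blast

lemma inj_chart: "c \<in> A \<Longrightarrow> inj_on (snd c) (fst c)"
  using smooth_atlas unfolding smooth_atlas_def by blast

lemma smooth_transition:
  "c \<in> A \<Longrightarrow> d \<in> A \<Longrightarrow> smooth_on (snd c ` (fst c \<inter> fst d)) (transition c d)"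
  using smooth_atlas unfolding smooth_atlas_def by blast

lemma chart_inv_chart: "c \<in> A \<Longrightarrow> p \<in> fst c \<Longrightarrow> chart_inv c (snd c p) = p"
  unfolding chart_inv_def by (rule inv_into_f_f[OF inj_chart])

lemma chart_chart_inv:
  "x \<in> snd c ` fst c \<Longrightarrow> snd c (chart_inv c x) = x \<and> chart_inv c x \<in> fst c"
  unfolding chart_inv_def by (simp add: f_inv_into_f inv_into_into)

lemma eventually_chart_domain:
  "c \<in> A \<Longrightarrow> p \<in> fst c \<Longrightarrow> eventually (\<lambda>x. x \<in> snd c ` fst c) (nhds (snd c p))"
  by (rule eventually_nhds_in_open[OF open_chart]) auto

lemma transition_chart: "c \<in> A \<Longrightarrow> p \<in> fst c \<Longrightarrow> transition c d (snd c p) = snd d p"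
  by (simp add: transition_def chart_inv_chart)

lemma transition_differentiable:
  assumes "c \<in> A" "d \<in> A" "p \<in> fst c" "p \<in> fst d"
  shows "transition c d differentiable (at (snd c p))"
  by (rule smooth_on_differentiable[OF smooth_transition]) (use assms in auto)

lemma fd_compose:
  assumes "f differentiable (at x)" "g differentiable (at (f x))"
  shows "fd (\<lambda>x. g (f x)) x u = fd g (f x) (fd f x u)"
proof -
  have "((\<lambda>x. g (f x)) has_derivative (\<lambda>u. fd g (f x) (fd f x u))) (at x)"
    by (rule has_derivative_compose[OF fd_works fd_works]) (rule assms)+
  from fd_eqI[OF this] show ?thesis by simp
qed

text \<open>The chain rule in the form used for the chart independence of differentials.\<close>

lemma change_of_chart:
  assumes c: "c \<in> A" "p \<in> fst c" and d: "d \<in> A" "p \<in> fst d"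
    and g: "(g \<circ> chart_inv d) differentiable (at (snd d p))"
  shows "fd (g \<circ> chart_inv c) (snd c p) u
    = fd (g \<circ> chart_inv d) (snd d p) (fd (transition c d) (snd c p) u)"
proof -
  have "eventually (\<lambda>x. x \<in> snd c ` (fst c \<inter> fst d)) (nhds (snd c p))"
    by (rule eventually_nhds_in_open[OF open_overlap]) (use assms in auto)
  then have "eventually (\<lambda>x. (g \<circ> chart_inv c) x = (g \<circ> chart_inv d) (transition c d x))
      (nhds (snd c p))"
    by eventually_elim (auto simp: chart_inv_chart c d transition_def)
  then have "fd (g \<circ> chart_inv c) (snd c p)
      = fd (\<lambda>x. (g \<circ> chart_inv d) (transition c d x)) (snd c p)"
    by (rule fd_cong_nhds)
  then show ?thesis
    using fd_compose[OF transition_differentiable[of c d p], of "g \<circ> chart_inv d" u] assms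
    by (simp add: transition_chart)
qed

lemma fd_transition_chain:
  assumes "c \<in> A" "p \<in> fst c" "d \<in> A" "p \<in> fst d" "k \<in> A" "p \<in> fst k"
  shows "fd (transition c k) (snd c p) u
    = fd (transition d k) (snd d p) (fd (transition c d) (snd c p) u)"
  using change_of_chart[OF assms(1-4), of "snd k" u] transition_differentiable[of d k p] assms
  by (simp add: transition_def)

lemma fd_transition_self:
  assumes "c \<in> A" "p \<in> fst c"
  shows "fd (transition c c) (snd c p) u = u"
proof -
  have "fd (transition c c) (snd c p) = fd (\<lambda>x. x) (snd c p)"
    by (rule fd_cong_open[OF open_chart]) (use assms in \<open>auto simp: transition_chart\<close>)
  then show ?thesis by simp
qed

subsection \<open>Tangent vectors\<close>

text \<open>As a function of the last argument this is the vector field on the domain of \<open>c\<close> with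
  constant components \<open>u\<close>; it supplies the local extensions in the definitions of the bracket with
  a vector 1-form and of the exterior derivative.\<close>

definition tangent_of :: "('a, 'e) chart \<Rightarrow> 'e \<Rightarrow> 'a \<Rightarrow> ('a, 'e) tvec" where
  "tangent_of c u p = (\<lambda>d. if d \<in> charts_at A p then fd (transition c d) (snd c p) u else 0)"

lemma tangentI:
  assumes "\<And>c d. c \<in> charts_at A p \<Longrightarrow> d \<in> charts_at A p \<Longrightarrow>
      v d = fd (transition c d) (snd c p) (v c)"
    and "\<And>c. c \<notin> charts_at A p \<Longrightarrow> v c = 0"
  shows "v \<in> tangent_space A p"
  using assms unfolding tangent_space_def by blast

lemma tangentD:
  "v \<in> tangent_space A p \<Longrightarrow> c \<in> charts_at A p \<Longrightarrow> d \<in> charts_at A p \<Longrightarrow>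
    v d = fd (transition c d) (snd c p) (v c)"
  unfolding tangent_space_def by blast

lemma tangent_of_mem: "c \<in> A \<Longrightarrow> p \<in> fst c \<Longrightarrow> tangent_of c u p \<in> tangent_space A p"
  by (rule tangentI) (auto simp: tangent_of_def charts_at_def intro!: fd_transition_chain)

lemma tangent_of_chart [simp]: "c \<in> A \<Longrightarrow> p \<in> fst c \<Longrightarrow> tangent_of c u p c = u"
  by (simp add: tangent_of_def charts_at_def fd_transition_self)

lemma tangent_transform:
  assumes "v \<in> tangent_space A p" "c \<in> A" "p \<in> fst c" "d \<in> A" "p \<in> fst d"
  shows "v d = fd (transition c d) (snd c p) (v c)"
  using assms unfolding tangent_space_def charts_at_def by blast

lemma tangent_outside: "v \<in> tangent_space A p \<Longrightarrow> d \<notin> charts_at A p \<Longrightarrow> v d = 0"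
  unfolding tangent_space_def by blast

lemma tangent_eqI:
  assumes v: "v \<in> tangent_space A p" and w: "w \<in> tangent_space A p"
    and c: "c \<in> A" "p \<in> fst c" and eq: "v c = w c"
  shows "v = w"
proof
  fix d
  show "v d = w d"
  proof (cases "d \<in> A \<and> p \<in> fst d")
    case True
    then show ?thesis
      using tangent_transform[OF v c, of d] tangent_transform[OF w c, of d] eq by simp
  next
    case False
    then have "d \<notin> charts_at A p" by (simp add: charts_at_def)
    then show ?thesis using tangent_outside[OF v] tangent_outside[OF w] by simp
  qed
qed

lemma fd_transition_linear:
  "c \<in> charts_at A p \<Longrightarrow> d \<in> charts_at A p \<Longrightarrow> linear (fd (transition c d) (snd c p))"
  unfolding charts_at_def by (auto intro: fd_linear transition_differentiable)

lemma tangent_zero [simp]: "0 \<in> tangent_space A p"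
  by (rule tangentI) (simp_all add: linear_0[OF fd_transition_linear])

lemma tangent_add:
  assumes v: "v \<in> tangent_space A p" and w: "w \<in> tangent_space A p"
  shows "v + w \<in> tangent_space A p"
proof (rule tangentI)
  fix c d assume c: "c \<in> charts_at A p" and d: "d \<in> charts_at A p"
  show "(v + w) d = fd (transition c d) (snd c p) ((v + w) c)"
    using tangentD[OF v c d] tangentD[OF w c d] linear_add[OF fd_transition_linear[OF c d]] by simp
qed (simp add: tangent_outside[OF v] tangent_outside[OF w])

lemma tangent_vscale:
  assumes v: "v \<in> tangent_space A p"
  shows "vscale r v \<in> tangent_space A p"
proof (rule tangentI)
  fix c d assume c: "c \<in> charts_at A p" and d: "d \<in> charts_at A p"
  show "vscale r v d = fd (transition c d) (snd c p) (vscale r v c)"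
    using tangentD[OF v c d] linear_scale[OF fd_transition_linear[OF c d]] by (simp add: vscale_def)
qed (simp add: tangent_outside[OF v] vscale_def)

lemma tangent_minus: "v \<in> tangent_space A p \<Longrightarrow> - v \<in> tangent_space A p"
  using tangent_vscale[of v p "-1"] by (simp add: vscale_def fun_Compl_def)

lemma tangent_diff:
  "v \<in> tangent_space A p \<Longrightarrow> w \<in> tangent_space A p \<Longrightarrow> v - w \<in> tangent_space A p"
  using tangent_add[of v p "- w"] tangent_minus[of w p] by simp

subsection \<open>Lie derivatives and brackets\<close>

abbreviation rep :: "('a, 'e) chart \<Rightarrow> ('a \<Rightarrow> ('a, 'e) tvec) \<Rightarrow> 'e \<Rightarrow> 'e" where
  "rep c X \<equiv> \<lambda>x. X (chart_inv c x) c"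

text \<open>Brackets at \<open>p\<close> depend on the components only through their values and first derivatives at \<open>p\<close>,
  and differentiability at the single point \<open>p\<close> in a single chart is what survives for fields such
  as \<open>J X\<close> built from a local extension.\<close>

definition diff_field :: "('a, 'e) chart \<Rightarrow> 'a \<Rightarrow> ('a \<Rightarrow> ('a, 'e) tvec) \<Rightarrow> bool" where
  "diff_field c p X \<longleftrightarrow> c \<in> A \<and> p \<in> fst c \<and> rep c X differentiable (at (snd c p)) \<and>
     (\<forall>\<^sub>F x in nhds (snd c p). X (chart_inv c x) \<in> tangent_space A (chart_inv c x))"

lemma diff_fieldD:
  assumes "diff_field c p X"
  shows "c \<in> A" "p \<in> fst c" "rep c X differentiable (at (snd c p))" "X p \<in> tangent_space A p"
    "\<forall>\<^sub>F x in nhds (snd c p). X (chart_inv c x) \<in> tangent_space A (chart_inv c x)"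
proof -
  show *: "c \<in> A" "p \<in> fst c" "rep c X differentiable (at (snd c p))"
    and ev: "\<forall>\<^sub>F x in nhds (snd c p). X (chart_inv c x) \<in> tangent_space A (chart_inv c x)"
    using assms by (auto simp: diff_field_def)
  show "X p \<in> tangent_space A p"
    using eventually_nhds_x_imp_x[OF ev] chart_inv_chart[OF *(1,2)] by simp
qed

text \<open>The description by \<open>THE\<close> picks the common value of the chart expressions, so that any one
  chart may be used.\<close>

lemma differential_chart:
  assumes c: "c \<in> A" "p \<in> fst c" and f: "(f \<circ> chart_inv c) differentiable (at (snd c p))"
    and v: "v \<in> tangent_space A p"
  shows "differential A f p v = fd (f \<circ> chart_inv c) (snd c p) (v c)"
proof -
  have eq: "fd (f \<circ> chart_inv d) (snd d p) (v d) = fd (f \<circ> chart_inv c) (snd c p) (v c)"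
    if "d \<in> charts_at A p" for d
  proof -
    from that have d: "d \<in> A" "p \<in> fst d" by (auto simp: charts_at_def)
    show ?thesis using change_of_chart[OF d c f] tangent_transform[OF v d c] by simp
  qed
  have c': "c \<in> charts_at A p" using c by (simp add: charts_at_def)
  show ?thesis
    unfolding differential_def
  proof (rule the_equality)
    show "\<forall>d\<in>charts_at A p. fd (f \<circ> chart_inv c) (snd c p) (v c)
        = fd (f \<circ> chart_inv d) (snd d p) (v d)"
      by (rule ballI) (rule eq[symmetric])
  qed (rule bspec[OF _ c'])
qed

lemma openin_chart_image:
  assumes "openin (atlas_topology A) W" "c \<in> A"
  shows "open (snd c ` (W \<inter> fst c))"
  using assms openin_atlas_topology[OF smooth_atlas] by blast

lemma openin_chart: "c \<in> A \<Longrightarrow> openin (atlas_topology A) (fst c)"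
  using openin_atlas_topology[OF smooth_atlas, of "fst c"] open_overlap[of _ c]
  by (auto simp: carrier_def Int_commute)

lemma vector_field_diff_field:
  assumes W: "openin (atlas_topology A) W" "p \<in> W" and X: "vector_field A W X"
    and c: "c \<in> A" "p \<in> fst c"
  shows "diff_field c p X"
proof -
  have "rep c X differentiable (at (snd c p))"
    using X W c unfolding vector_field_def
    by (intro smooth_on_differentiable[of "snd c ` (W \<inter> fst c)"]) auto
  moreover have "\<forall>\<^sub>F x in nhds (snd c p). x \<in> snd c ` (W \<inter> fst c)"
    using W c by (intro eventually_nhds_in_open openin_chart_image) auto
  then have "\<forall>\<^sub>F x in nhds (snd c p). X (chart_inv c x) \<in> tangent_space A (chart_inv c x)"
    by eventually_elim (use X c in \<open>auto simp: vector_field_def chart_inv_chart\<close>)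
  ultimately show ?thesis using c by (simp add: diff_field_def)
qed

lemma lie_deriv_chart:
  assumes c: "c \<in> A" and x: "x \<in> snd c ` fst c"
    and f: "(f \<circ> chart_inv c) differentiable (at x)"
    and X: "X (chart_inv c x) \<in> tangent_space A (chart_inv c x)"
  shows "lie_deriv A X f (chart_inv c x) = fd (f \<circ> chart_inv c) x (rep c X x)"
  unfolding lie_deriv_def
  using differential_chart[OF c, of "chart_inv c x" f] chart_chart_inv[OF x] f X by simp

text \<open>The function \<open>Y f\<close> agrees near \<open>p\<close> with the derivative of \<open>f\<close> along the moving components of \<open>Y\<close>.\<close>

lemma has_derivative_lie_deriv:
  assumes Y: "diff_field c p Y" and S: "open S" "snd c p \<in> S"
    and f: "Ck_on 2 S (f \<circ> chart_inv c)"
  shows "((lie_deriv A Y f \<circ> chart_inv c) has_derivative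
     (\<lambda>h. D2 (f \<circ> chart_inv c) (snd c p) h (Y p c)
       + fd (f \<circ> chart_inv c) (snd c p) (fd (rep c Y) (snd c p) h))) (at (snd c p))"
proof -
  note Y' = diff_fieldD[OF Y]
  have "\<forall>\<^sub>F x in nhds (snd c p). fd (f \<circ> chart_inv c) x (rep c Y x) = (lie_deriv A Y f \<circ> chart_inv c) x"
    using eventually_chart_domain[OF Y'(1,2)] Y'(5) eventually_nhds_in_open[OF S]
  proof eventually_elim
    case (elim x)
    then show ?case
      using lie_deriv_chart[where X = Y, OF Y'(1) elim(1) Ck_on_2D(1)[OF f elim(3)] elim(2)] by simp
  qed
  from has_derivative_cong_nhds[OF this has_derivative_fd_apply[OF S f fd_works[OF Y'(3)]]]
  show ?thesis by (simp only: chart_inv_chart[OF Y'(1,2)])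
qed

lemma lie_deriv_lie_deriv:
  assumes X: "X p \<in> tangent_space A p" and Y: "diff_field c p Y" and S: "open S" "snd c p \<in> S"
    and f: "Ck_on 2 S (f \<circ> chart_inv c)"
  shows "lie_deriv A X (lie_deriv A Y f) p = D2 (f \<circ> chart_inv c) (snd c p) (X p c) (Y p c)
       + fd (f \<circ> chart_inv c) (snd c p) (fd (rep c Y) (snd c p) (X p c))"
proof -
  note Y' = diff_fieldD[OF Y]
  note D = has_derivative_lie_deriv[OF Y S f]
  have "lie_deriv A X (lie_deriv A Y f) p
      = fd (lie_deriv A Y f \<circ> chart_inv c) (snd c p) (X p c)"
    unfolding lie_deriv_def[of A X]
    using D by (intro differential_chart Y' X) (auto simp: differentiable_def)
  then show ?thesis using fd_eqI[OF D] by simp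
qed

lemma smooth_fun_coordinate:
  assumes c: "c \<in> A"
  shows "smooth_fun A (fst c) (\<lambda>q. snd c q \<bullet> i)"
proof -
  have "smooth_on (snd d ` (fst c \<inter> fst d)) ((\<lambda>q. snd c q \<bullet> i) \<circ> chart_inv d)" if d: "d \<in> A" for d
  proof -
    have "smooth_on (snd d ` (fst d \<inter> fst c)) (\<lambda>x. transition d c x \<bullet> i)"
      by (rule smooth_on_linear[OF open_overlap bounded_linear_inner_left smooth_transition])
        (rule c d)+
    then show ?thesis by (simp add: transition_def o_def Int_commute)
  qed
  then show ?thesis by (auto simp: smooth_fun_def Ck_fun_def smooth_on_def)
qed

text \<open>In the commutator the second derivatives of the test function cancel by symmetry, which gives
  existence; the coordinates of the chart, used as test functions on its domain, give uniqueness.\<close>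

lemma lie_bracket_chart:
  assumes X: "diff_field c p X" and Y: "diff_field c p Y"
  shows "lie_bracket A X Y p \<in> tangent_space A p"
    and "lie_bracket A X Y p c
      = fd (rep c Y) (snd c p) (X p c) - fd (rep c X) (snd c p) (Y p c)"
proof -
  note X' = diff_fieldD[OF X] and Y' = diff_fieldD[OF Y]
  note c = X'(1,2)
  let ?P = "\<lambda>z. z \<in> tangent_space A p \<and>
     (\<forall>W f. openin (atlas_topology A) W \<and> p \<in> W \<and> smooth_fun A W f \<longrightarrow>
        differential A f p z =
          lie_deriv A X (lie_deriv A Y f) p - lie_deriv A Y (lie_deriv A X f) p)"
  let ?u = "fd (rep c Y) (snd c p) (X p c) - fd (rep c X) (snd c p) (Y p c)"
  define z where "z = tangent_of c ?u p"
  have z: "z \<in> tangent_space A p" "z c = ?u"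
    using tangent_of_mem[OF c] c by (auto simp: z_def)
  have "?P z"
  proof (intro conjI z allI impI)
    fix W f assume "openin (atlas_topology A) W \<and> p \<in> W \<and> smooth_fun A W f"
    then have W: "openin (atlas_topology A) W" "p \<in> W" and f: "smooth_fun A W f" by auto
    define S where "S = snd c ` (W \<inter> fst c)"
    have S: "open S" "snd c p \<in> S"
      using openin_chart_image[OF W(1) c(1)] W c by (auto simp: S_def)
    have f2: "Ck_on 2 S (f \<circ> chart_inv c)"
      using f c by (simp add: smooth_fun_def Ck_fun_def S_def)
    note df = Ck_on_2D(1)[OF f2 S(2)]
    show "differential A f p z =
          lie_deriv A X (lie_deriv A Y f) p - lie_deriv A Y (lie_deriv A X f) p"
      unfolding differential_chart[OF c df z(1)] lie_deriv_lie_deriv[where X = X and Y = Y, OF X'(4) Y S f2]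
        lie_deriv_lie_deriv[where X = Y and Y = X, OF Y'(4) X S f2] z(2)
        linear_diff[OF fd_linear[OF df]] D2_symmetric[OF S f2, of "X p c"] by simp
  qed
  moreover have "z' = z" if z': "?P z'" for z'
  proof -
    have "z' c \<bullet> i = z c \<bullet> i" for i
    proof -
      \<comment> \<open>The differential of a coordinate function reads off the corresponding component.\<close>
      let ?f = "\<lambda>q. snd c q \<bullet> i"
      have "((\<lambda>x. x \<bullet> i) has_derivative (\<lambda>h. h \<bullet> i)) (at (snd c p))"
        by (intro derivative_intros)
      then have D: "((?f \<circ> chart_inv c) has_derivative (\<lambda>h. h \<bullet> i)) (at (snd c p))"
        by (rule has_derivative_transform_within_open[OF _ open_chart[OF c(1)]])
          (use c in \<open>auto simp: chart_inv_chart\<close>)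
      have "differential A ?f p w = w c \<bullet> i" if "w \<in> tangent_space A p" for w
        using differential_chart[OF c differentiableI[OF D] that] by (simp add: fd_eqI[OF D])
      then show ?thesis
        using z' \<open>?P z\<close> openin_chart[OF c(1)] smooth_fun_coordinate[OF c(1), of i] c(2) by metis
    qed
    then have "z' c = z c" by (metis euclidean_eqI)
    then show "z' = z" using tangent_eqI[OF _ z(1) c] z' by blast
  qed
  ultimately have "lie_bracket A X Y p = z" unfolding lie_bracket_def by (rule the_equality)
  then show "lie_bracket A X Y p \<in> tangent_space A p" "lie_bracket A X Y p c = ?u"
    using z by auto
qed

lemma vector_field_tangent_of:
  assumes c: "c \<in> A" shows "vector_field A (fst c) (tangent_of c u)"
proof -
  have "smooth_on (snd d ` (fst c \<inter> fst d)) (rep d (tangent_of c u))" if d: "d \<in> A" for d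
  proof -
    have "smooth_on (snd d ` (fst d \<inter> fst c)) (\<lambda>x. fd (transition c d) (transition d c x) u)"
      by (rule smooth_on_compose[OF open_overlap[OF d c] open_overlap[OF c d] _
            smooth_transition[OF d c] smooth_on_fd[OF smooth_transition[OF c d]]])
        (use c d in \<open>auto simp: transition_chart\<close>)
    then have "smooth_on (snd d ` (fst d \<inter> fst c)) (rep d (tangent_of c u))"
      by (rule smooth_on_transform[OF _ open_overlap[OF d c]])
        (use d in \<open>auto simp: chart_inv_chart tangent_of_def charts_at_def transition_def\<close>)
    then show ?thesis by (simp add: Int_commute)
  qed
  then show ?thesis using tangent_of_mem[OF c] by (simp add: vector_field_def)
qed

lemma tangent_extension:
  assumes "v \<in> tangent_space A p" "c \<in> A" "p \<in> fst c"
  obtains X where "vector_field A (fst c) X" "X p = v"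
  using that[OF vector_field_tangent_of[OF assms(2)], of "v c"]
    tangent_eqI[OF tangent_of_mem[OF assms(2,3), of "v c"] assms] assms by simp

text \<open>A value that does not depend on the extension is the value of the bracket, because an extension
  exists: the field with constant components.\<close>

lemma FN_bracket_eqI:
  assumes c: "c \<in> A" "p \<in> fst c" and v: "v \<in> tangent_space A p"
    and eq: "\<And>X. diff_field c p X \<Longrightarrow> X p = v \<Longrightarrow>
      z = lie_bracket A (\<lambda>q. K q (X q)) Y p - K p (lie_bracket A X Y p)"
  shows "FN_bracket A K Y p v = z"
  unfolding FN_bracket_def
proof (rule the_equality)
  show "\<forall>W X. openin (atlas_topology A) W \<and> p \<in> W \<and> vector_field A W X \<and> X p = v \<longrightarrow>
      z = lie_bracket A (\<lambda>q. K q (X q)) Y p - K p (lie_bracket A X Y p)"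
    using eq vector_field_diff_field[OF _ _ _ c] by blast
next
  obtain X where X: "vector_field A (fst c) X" "X p = v" using tangent_extension[OF v c] .
  fix z' assume "\<forall>W X. openin (atlas_topology A) W \<and> p \<in> W \<and> vector_field A W X \<and> X p = v \<longrightarrow>
      z' = lie_bracket A (\<lambda>q. K q (X q)) Y p - K p (lie_bracket A X Y p)"
  then have "z' = lie_bracket A (\<lambda>q. K q (X q)) Y p - K p (lie_bracket A X Y p)"
    using X openin_chart[OF c(1)] c by blast
  then show "z' = z"
    using eq[OF vector_field_diff_field[OF openin_chart[OF c(1)] c(2) X(1) c] X(2)] by simp
qed

lemma ext_deriv_eqI:
  assumes c: "c \<in> A" "p \<in> fst c" and v: "v \<in> tangent_space A p" and w: "w \<in> tangent_space A p"
    and eq: "\<And>X Y. diff_field c p X \<Longrightarrow> diff_field c p Y \<Longrightarrow> X p = v \<Longrightarrow> Y p = w \<Longrightarrow>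
      r = lie_deriv A X (\<lambda>q. \<beta> q (Y q)) p - lie_deriv A Y (\<lambda>q. \<beta> q (X q)) p
           - \<beta> p (lie_bracket A X Y p)"
  shows "ext_deriv A \<beta> p v w = r"
  unfolding ext_deriv_def
proof (rule the_equality)
  show "\<forall>W X Y. openin (atlas_topology A) W \<and> p \<in> W \<and> vector_field A W X \<and> vector_field A W Y \<and>
     X p = v \<and> Y p = w \<longrightarrow>
      r = lie_deriv A X (\<lambda>q. \<beta> q (Y q)) p - lie_deriv A Y (\<lambda>q. \<beta> q (X q)) p
           - \<beta> p (lie_bracket A X Y p)"
    using eq vector_field_diff_field[OF _ _ _ c] by blast
next
  obtain X where X: "vector_field A (fst c) X" "X p = v" using tangent_extension[OF v c] .
  obtain Y where Y: "vector_field A (fst c) Y" "Y p = w" using tangent_extension[OF w c] .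
  fix r' assume "\<forall>W X Y. openin (atlas_topology A) W \<and> p \<in> W \<and> vector_field A W X \<and>
     vector_field A W Y \<and> X p = v \<and> Y p = w \<longrightarrow>
      r' = lie_deriv A X (\<lambda>q. \<beta> q (Y q)) p - lie_deriv A Y (\<lambda>q. \<beta> q (X q)) p
           - \<beta> p (lie_bracket A X Y p)"
  then have "r' = lie_deriv A X (\<lambda>q. \<beta> q (Y q)) p - lie_deriv A Y (\<lambda>q. \<beta> q (X q)) p
           - \<beta> p (lie_bracket A X Y p)"
    using X Y openin_chart[OF c(1)] c by blast
  then show "r' = r"
    using eq[OF vector_field_diff_field[OF openin_chart[OF c(1)] c(2) X(1) c]
        vector_field_diff_field[OF openin_chart[OF c(1)] c(2) Y(1) c] X(2) Y(2)] by simp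
qed

end

section \<open>The tangent bundle\<close>

context atlas
begin

abbreviation tc :: "('a, 'e) chart \<Rightarrow> (('a, 'e) tpoint, 'e \<times> 'e) chart" where
  "tc \<equiv> tangent_chart A"

lemma tc_domain: "p \<in> fst (tc c) \<longleftrightarrow> fst p \<in> fst c \<and> snd p \<in> tangent_space A (fst p)"
  by (cases p) (simp add: tangent_chart_def)

lemma tc_apply: "snd (tc c) p = (snd c (fst p), snd p c)"
  by (cases p) (simp add: tangent_chart_def)

text \<open>Every vector of \<open>'e\<close> occurs as the component of a tangent vector, so a chart of the tangent bundle
  covers full fibres.\<close>

lemma tc_overlap_image:
  assumes "c \<in> A" "d \<in> A"
  shows "snd (tc c) ` (fst (tc c) \<inter> fst (tc d)) = (snd c ` (fst c \<inter> fst d)) \<times> UNIV"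
proof (intro equalityI subsetI)
  fix z assume "z \<in> snd (tc c) ` (fst (tc c) \<inter> fst (tc d))"
  then show "z \<in> (snd c ` (fst c \<inter> fst d)) \<times> UNIV" by (auto simp: tc_domain tc_apply)
next
  fix z assume "z \<in> (snd c ` (fst c \<inter> fst d)) \<times> (UNIV :: 'e set)"
  then obtain q u where q: "q \<in> fst c" "q \<in> fst d" and z: "z = (snd c q, u)" by auto
  have "z = snd (tc c) (q, tangent_of c u q)" using q assms by (simp add: z tc_apply)
  moreover have "(q, tangent_of c u q) \<in> fst (tc c) \<inter> fst (tc d)"
    using q assms tangent_of_mem by (simp add: tc_domain)
  ultimately show "z \<in> snd (tc c) ` (fst (tc c) \<inter> fst (tc d))" by blast
qed

lemma tc_image: "c \<in> A \<Longrightarrow> snd (tc c) ` fst (tc c) = (snd c ` fst c) \<times> UNIV"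
  using tc_overlap_image[of c c] by simp

lemma tc_inj: "c \<in> A \<Longrightarrow> inj_on (snd (tc c)) (fst (tc c))"
proof (rule inj_onI)
  fix p q assume c: "c \<in> A" and p: "p \<in> fst (tc c)" and q: "q \<in> fst (tc c)"
    and eq: "snd (tc c) p = snd (tc c) q"
  have b: "fst p = fst q"
    using inj_onD[OF inj_chart[OF c]] p q eq by (simp add: tc_domain tc_apply)
  moreover have "snd p = snd q"
    using p q eq b by (intro tangent_eqI[of "snd p" "fst p" "snd q" c])
      (auto simp: tc_domain tc_apply c)
  ultimately show "p = q" by (simp add: prod_eq_iff)
qed

lemma tc_inv:
  assumes c: "c \<in> A" and x: "x \<in> snd c ` fst c"
  shows "chart_inv (tc c) (x, u) = (chart_inv c x, tangent_of c u (chart_inv c x))"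
  unfolding chart_inv_def[of "tc c"]
  by (rule inv_into_f_eq[OF tc_inj[OF c]])
    (use chart_chart_inv[OF x] c tangent_of_mem in \<open>auto simp: tc_domain tc_apply\<close>)

lemma tc_transition:
  assumes c: "c \<in> A" and d: "d \<in> A" and x: "x \<in> snd c ` (fst c \<inter> fst d)"
  shows "transition (tc c) (tc d) (x, u) = (transition c d x, fd (transition c d) x u)"
proof -
  from x have x': "x \<in> snd c ` fst c" by auto
  have "chart_inv c x \<in> fst d" using x c by (auto simp: chart_inv_chart)
  then show ?thesis
    using tc_inv[OF c x'] chart_chart_inv[OF x'] d
    by (simp add: transition_def[of "tc c"] tc_apply transition_def[of c d] tangent_of_def charts_at_def
        o_def)
qed

lemma smooth_tangent_atlas: "smooth_atlas (tangent_atlas A)"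
  unfolding smooth_atlas_def tangent_atlas_def
proof (intro conjI ballI; elim imageE; hypsubst)
  fix c assume c: "c \<in> A"
  show "inj_on (snd (tc c)) (fst (tc c))" by (rule tc_inj[OF c])
  show "open (snd (tc c) ` fst (tc c))" unfolding tc_image[OF c]
    by (intro open_Times open_chart c open_UNIV)
next
  fix c d assume c: "c \<in> A" and d: "d \<in> A"
  define S where "S = snd c ` (fst c \<inter> fst d)"
  have S: "open S" unfolding S_def by (rule open_overlap[OF c d])
  have \<tau>: "smooth_on S (transition c d)" unfolding S_def by (rule smooth_transition[OF c d])
  have SU: "open (S \<times> (UNIV :: 'e set))" by (intro open_Times S open_UNIV)
  then show "open (snd (tc c) ` (fst (tc c) \<inter> fst (tc d)))"
    unfolding tc_overlap_image[OF c d] S_def .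
  have fst: "smooth_on (S \<times> (UNIV :: 'e set)) fst" and snd: "smooth_on (S \<times> (UNIV :: 'e set)) snd"
    using smooth_on_linear[OF SU bounded_linear_fst smooth_on_id]
      smooth_on_linear[OF SU bounded_linear_snd smooth_on_id] by simp_all
  have comp: "smooth_on (S \<times> (UNIV :: 'e set)) (\<lambda>z. g (fst z))" if "smooth_on S g"
    for g :: "'e \<Rightarrow> 'e"
    by (rule smooth_on_compose[OF SU S _ fst that]) auto
  have "smooth_on (S \<times> (UNIV :: 'e set)) (\<lambda>z. fd (transition c d) (fst z) (snd z))"
  proof (rule smooth_on_bilinear_apply[OF SU _ _ snd])
    show "linear (fd (transition c d) (fst z))" if "z \<in> S \<times> UNIV" for z :: "'e \<times> 'e"
      using that by (intro fd_linear smooth_on_differentiable[OF \<tau>]) auto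
    show "smooth_on (S \<times> (UNIV :: 'e set)) (\<lambda>z. fd (transition c d) (fst z) u)" for u
      by (rule comp[OF smooth_on_fd[OF \<tau>]])
  qed
  from smooth_on_Pair[OF SU comp[OF \<tau>] this]
  have "smooth_on (S \<times> (UNIV :: 'e set)) (transition (tc c) (tc d))"
    by (rule smooth_on_transform[OF _ SU]) (auto simp: S_def tc_transition[OF c d])
  then show "smooth_on (snd (tc c) ` (fst (tc c) \<inter> fst (tc d))) (transition (tc c) (tc d))"
    unfolding tc_overlap_image[OF c d] S_def .
qed

end

text \<open>A locale of its own, because interpreting \<open>atlas\<close> for the tangent atlas inside \<open>atlas\<close> itself would
  generate the tower of all iterated tangent bundles.\<close>

locale atlas_with_bundle = atlas A for A :: "('a, 'e::euclidean_space) chart set"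
begin

sublocale T: atlas "tangent_atlas A"
  by unfold_locales (rule smooth_tangent_atlas)

abbreviation TTM :: "('a, 'e) tpoint \<Rightarrow> (('a, 'e) tpoint, 'e \<times> 'e) tvec set" where
  "TTM \<equiv> tangent_space (tangent_atlas A)"

lemma tc_mem: "c \<in> A \<Longrightarrow> tc c \<in> tangent_atlas A"
  by (simp add: tangent_atlas_def)

lemma fst_fd_tc_transition:
  assumes c: "c \<in> A" "p \<in> fst (tc c)" and d: "d \<in> A" "p \<in> fst (tc d)"
  shows "fst (fd (transition (tc c) (tc d)) (snd (tc c) p) h)
    = fd (transition c d) (snd c (fst p)) (fst h)"
proof -
  let ?T = "transition (tc c) (tc d)" and ?z = "snd (tc c) p" and ?S = "snd c ` (fst c \<inter> fst d)"
  have p: "fst p \<in> fst c" "fst p \<in> fst d" using c d by (auto simp: tc_domain)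
  have z: "?z \<in> ?S \<times> UNIV" using p by (auto simp: tc_apply)
  have S: "open (?S \<times> (UNIV::'e set))" by (intro open_Times open_overlap c d open_UNIV)
  have "(?T has_derivative fd ?T ?z) (at ?z)"
    by (intro fd_works T.transition_differentiable tc_mem c d)
  then have "((\<lambda>z. fst (?T z)) has_derivative (\<lambda>h. fst (fd ?T ?z h))) (at ?z)"
    by (rule has_derivative_fst)
  then have 1: "((\<lambda>z. transition c d (fst z)) has_derivative (\<lambda>h. fst (fd ?T ?z h))) (at ?z)"
    by (rule has_derivative_transform_within_open[OF _ S z]) (auto simp: tc_transition[OF c(1) d(1)])
  have "(transition c d has_derivative fd (transition c d) (fst ?z)) (at (fst ?z))"
    using transition_differentiable[OF c(1) d(1) p] by (intro fd_works) (simp add: tc_apply)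
  from fd_eqI[OF has_derivative_compose[OF has_derivative_fst[OF has_derivative_ident] this]]
  show ?thesis using fun_cong[OF fd_eqI[OF 1], of h] by (simp add: tc_apply)
qed

text \<open>On the fibre over a fixed base point the transition map is linear, namely the
  derivative of the transition of the base, so it carries vertical vectors to vertical vectors.\<close>

lemma fd_tc_transition_vertical:
  assumes c: "c \<in> A" "p \<in> fst (tc c)" and d: "d \<in> A" "p \<in> fst (tc d)"
  shows "fd (transition (tc c) (tc d)) (snd (tc c) p) (0, b)
    = (0, fd (transition c d) (snd c (fst p)) b)"
proof -
  let ?T = "transition (tc c) (tc d)" and ?\<tau> = "transition c d"
  define x u where "x = snd c (fst p)" and "u = snd p c"
  have p: "fst p \<in> fst c" "fst p \<in> fst d" using c d by (auto simp: tc_domain)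
  have z: "snd (tc c) p = (x, u)" by (simp add: x_def u_def tc_apply)
  have x: "x \<in> snd c ` (fst c \<inter> fst d)" using p by (auto simp: x_def)
  have lin: "linear (fd ?\<tau> x)"
    unfolding x_def by (intro fd_linear transition_differentiable c d p)
  have "(?T has_derivative fd ?T (x, u)) (at (x, u))"
    unfolding z[symmetric] by (intro fd_works T.transition_differentiable tc_mem c d)
  then have T: "(?T has_derivative fd ?T (x, u)) (at (x, u + 0 *\<^sub>R b))" by simp
  have "((\<lambda>t. (x, u + t *\<^sub>R b)) has_derivative (\<lambda>t. (0, t *\<^sub>R b))) (at (0::real))"
    by (auto intro!: derivative_eq_intros)
  from has_derivative_compose[OF this T]
  have "((\<lambda>t. ?T (x, u + t *\<^sub>R b)) has_derivative (\<lambda>t. fd ?T (x, u) (0, t *\<^sub>R b))) (at (0::real))" .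
  moreover have "(\<lambda>t. ?T (x, u + t *\<^sub>R b)) = (\<lambda>t. (?\<tau> x, fd ?\<tau> x u + t *\<^sub>R fd ?\<tau> x b))"
    by (simp add: tc_transition[OF c(1) d(1) x] linear_add[OF lin] linear_scale[OF lin])
  moreover have "((\<lambda>t. (?\<tau> x, fd ?\<tau> x u + t *\<^sub>R fd ?\<tau> x b)) has_derivative
      (\<lambda>t. (0, t *\<^sub>R fd ?\<tau> x b))) (at (0::real))"
    by (auto intro!: derivative_eq_intros)
  ultimately have "(\<lambda>t. fd ?T (x, u) (0, t *\<^sub>R b)) = (\<lambda>t. (0, t *\<^sub>R fd ?\<tau> x b))"
    using has_derivative_unique by metis
  from fun_cong[OF this, of 1] show ?thesis by (simp add: z x_def)
qed

lemma proj_map_chart: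
  assumes c: "c \<in> A" "p \<in> fst (tc c)" and \<xi>: "\<xi> \<in> TTM p"
  shows "proj_map A p \<xi> \<in> tangent_space A (fst p)" "proj_map A p \<xi> c = fst (\<xi> (tc c))"
proof -
  have D: "fd (snd d \<circ> fst \<circ> chart_inv (tc k)) (snd (tc k) p) h
      = fd (transition k d) (snd k (fst p)) (fst h)"
    if k: "k \<in> A" "p \<in> fst (tc k)" and d: "d \<in> A" "fst p \<in> fst d" for k d h
  proof -
    have p: "fst p \<in> fst k" using k by (auto simp: tc_domain)
    have "fd (snd d \<circ> fst \<circ> chart_inv (tc k)) (snd (tc k) p)
        = fd (\<lambda>z. transition k d (fst z)) (snd (tc k) p)"
    proof (rule fd_cong_open)
      show "open ((snd k ` fst k) \<times> (UNIV :: 'e set))"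
        by (intro open_Times open_chart k open_UNIV)
    qed (use p in \<open>auto simp: tc_apply tc_inv[OF k(1)] transition_def\<close>)
    moreover have "(transition k d has_derivative fd (transition k d) (snd k (fst p)))
        (at (fst (snd (tc k) p)))"
      using transition_differentiable[OF k(1) d(1) p d(2)] by (simp add: tc_apply fd_works)
    from fd_eqI[OF has_derivative_compose[OF has_derivative_fst[OF has_derivative_ident] this]]
    have "fd (\<lambda>z. transition k d (fst z)) (snd (tc k) p) h
        = fd (transition k d) (snd k (fst p)) (fst h)" by (rule fun_cong)
    ultimately show ?thesis by simp
  qed
  have p: "fst p \<in> fst c" using c by (auto simp: tc_domain)
  define w where "w = tangent_of c (fst (\<xi> (tc c))) (fst p)"
  let ?P = "\<lambda>w. w \<in> tangent_space A (fst p) \<and>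
     (\<forall>C\<in>charts_at (tangent_atlas A) p. \<forall>d\<in>charts_at A (fst p).
        w d = fd (snd d \<circ> fst \<circ> chart_inv C) (snd C p) (\<xi> C))"
  have w: "w \<in> tangent_space A (fst p)" "w c = fst (\<xi> (tc c))"
    using tangent_of_mem[OF c(1) p] c p by (auto simp: w_def)
  have "?P w"
  proof (intro conjI w ballI)
    fix C d assume C: "C \<in> charts_at (tangent_atlas A) p" and "d \<in> charts_at A (fst p)"
    then have d: "d \<in> A" "fst p \<in> fst d" by (auto simp: charts_at_def)
    obtain k where k: "k \<in> A" "p \<in> fst (tc k)" and Ck: "C = tc k"
      using C by (auto simp: charts_at_def tangent_atlas_def)
    have pk: "fst p \<in> fst k" using k by (auto simp: tc_domain)
    have "\<xi> C = fd (transition (tc c) (tc k)) (snd (tc c) p) (\<xi> (tc c))"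
      unfolding Ck by (intro T.tangent_transform \<xi> tc_mem c k)
    then have "fst (\<xi> C) = fd (transition c k) (snd c (fst p)) (fst (\<xi> (tc c)))"
      using fst_fd_tc_transition[OF c k] by simp
    moreover have "w d = fd (transition k d) (snd k (fst p))
        (fd (transition c k) (snd c (fst p)) (fst (\<xi> (tc c))))"
      using tangent_transform[OF w(1) c(1) p d] fd_transition_chain[OF c(1) p k(1) pk d] w(2) by simp
    ultimately show "w d = fd (snd d \<circ> fst \<circ> chart_inv C) (snd C p) (\<xi> C)"
      using D[OF k d] by (simp add: Ck)
  qed
  moreover have "w' = w" if "?P w'" for w'
  proof (rule tangent_eqI[OF _ w(1) c(1) p])
    show "w' \<in> tangent_space A (fst p)" using that by blast
    have "tc c \<in> charts_at (tangent_atlas A) p" "c \<in> charts_at A (fst p)"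
      using c p tc_mem by (auto simp: charts_at_def)
    then have "w' c = fd (snd c \<circ> fst \<circ> chart_inv (tc c)) (snd (tc c) p) (\<xi> (tc c))"
      using that by blast
    then show "w' c = w c" using D[OF c c(1) p] fd_transition_self[OF c(1) p] w(2) by simp
  qed
  ultimately have "proj_map A p \<xi> = w"
    unfolding proj_map_def tangent_map_def by (rule the_equality)
  then show "proj_map A p \<xi> \<in> tangent_space A (fst p)" "proj_map A p \<xi> c = fst (\<xi> (tc c))"
    using w by auto
qed

lemma vertical_lift_chart:
  assumes c: "c \<in> A" "p \<in> fst (tc c)" and w: "w \<in> tangent_space A (fst p)"
  shows "vertical_lift A p w \<in> TTM p" "vertical_lift A p w (tc c) = (0, w c)"
proof -
  have start: "(fst p, snd p + vscale 0 w) = p"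
    by (simp add: prod_eq_iff vscale_def fun_eq_iff)
  have val: "vertical_lift A p w (tc d) = (0, w d)" if d: "d \<in> A" "p \<in> fst (tc d)" for d
  proof -
    have "((\<lambda>t. (snd d (fst p), snd p d + t *\<^sub>R w d)) has_vector_derivative (0, w d)) (at 0)"
      unfolding has_vector_derivative_def by (auto intro!: derivative_eq_intros)
    then have "vector_derivative (snd (tc d) \<circ> (\<lambda>t. (fst p, snd p + vscale t w))) (at 0) = (0, w d)"
      by (intro vector_derivative_at) (simp add: o_def tc_apply vscale_def)
    moreover have "tc d \<in> charts_at (tangent_atlas A) p"
      using d tc_mem by (simp add: charts_at_def)
    ultimately show ?thesis
      unfolding vertical_lift_def velocity_def start by simp
  qed
  show "vertical_lift A p w (tc c) = (0, w c)" by (rule val[OF c])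
  show "vertical_lift A p w \<in> TTM p"
  proof (rule T.tangentI)
    fix C D assume "C \<in> charts_at (tangent_atlas A) p" "D \<in> charts_at (tangent_atlas A) p"
    then obtain k d where k: "k \<in> A" "p \<in> fst (tc k)" "C = tc k"
      and d: "d \<in> A" "p \<in> fst (tc d)" "D = tc d"
      by (auto simp: charts_at_def tangent_atlas_def)
    have "w d = fd (transition k d) (snd k (fst p)) (w k)"
      using tangent_transform[OF w k(1) _ d(1)] k(2) d(2) by (simp add: tc_domain)
    then show "vertical_lift A p w D = fd (transition C D) (snd C p) (vertical_lift A p w C)"
      unfolding k(3) d(3) val[OF k(1,2)] val[OF d(1,2)]
        fd_tc_transition_vertical[OF k(1,2) d(1,2)] by simp
  next
    fix C assume "C \<notin> charts_at (tangent_atlas A) p"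
    then show "vertical_lift A p w C = 0"
      unfolding vertical_lift_def velocity_def start by simp
  qed
qed

lemma vertical_endo_chart:
  assumes "c \<in> A" "p \<in> fst (tc c)" "\<xi> \<in> TTM p"
  shows "vertical_endo A p \<xi> \<in> TTM p" "vertical_endo A p \<xi> (tc c) = (0, fst (\<xi> (tc c)))"
  unfolding vertical_endo_def
  using vertical_lift_chart[OF assms(1,2) proj_map_chart(1)[OF assms]] proj_map_chart(2)[OF assms]
  by auto

lemma liouville_chart:
  assumes "c \<in> A" "p \<in> fst (tc c)"
  shows "liouville A p \<in> TTM p" "liouville A p (tc c) = (0, snd p c)"
  unfolding liouville_def using vertical_lift_chart[OF assms, of "snd p"] assms
  by (auto simp: tc_domain)

lemma proj_map_eq_0_iff:
  assumes "c \<in> A" "p \<in> fst (tc c)" "\<xi> \<in> TTM p"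
  shows "proj_map A p \<xi> = 0 \<longleftrightarrow> fst (\<xi> (tc c)) = 0"
proof -
  note P = proj_map_chart[OF assms]
  have "proj_map A p \<xi> = 0" if "proj_map A p \<xi> c = 0"
    using tangent_eqI[OF P(1) tangent_zero assms(1)] that assms(2) by (simp add: tc_domain)
  then show ?thesis using P(2) by auto
qed

subsection \<open>The vertical endomorphism and the fundamental form in a chart\<close>

lemma diff_field_vertical_endo:
  assumes X: "T.diff_field (tc c) p X" and c: "c \<in> A"
  shows "T.diff_field (tc c) p (\<lambda>q. vertical_endo A q (X q))"
    and "fd (T.rep (tc c) (\<lambda>q. vertical_endo A q (X q))) (snd (tc c) p) h
      = (0, fst (fd (T.rep (tc c) X) (snd (tc c) p) h))"
proof -
  note X' = T.diff_fieldD[OF X]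
  have "\<forall>\<^sub>F z in nhds (snd (tc c) p). z \<in> snd (tc c) ` fst (tc c)"
    by (rule T.eventually_chart_domain[OF X'(1,2)])
  then have ev: "\<forall>\<^sub>F z in nhds (snd (tc c) p). X (chart_inv (tc c) z) \<in> TTM (chart_inv (tc c) z)
      \<and> chart_inv (tc c) z \<in> fst (tc c)"
    using X'(5) by eventually_elim (simp add: T.chart_chart_inv)
  then have ev1: "\<forall>\<^sub>F z in nhds (snd (tc c) p).
      vertical_endo A (chart_inv (tc c) z) (X (chart_inv (tc c) z)) \<in> TTM (chart_inv (tc c) z)"
    by eventually_elim (simp add: vertical_endo_chart(1)[OF c])
  from ev have ev2: "\<forall>\<^sub>F z in nhds (snd (tc c) p). (0, fst (T.rep (tc c) X z)) =
      T.rep (tc c) (\<lambda>q. vertical_endo A q (X q)) z"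
    by eventually_elim (simp add: vertical_endo_chart(2)[OF c])
  have "((\<lambda>z. (0::'e, fst (T.rep (tc c) X z))) has_derivative
     (\<lambda>h. (0, fst (fd (T.rep (tc c) X) (snd (tc c) p) h)))) (at (snd (tc c) p))"
    by (intro has_derivative_Pair has_derivative_const has_derivative_fst fd_works X'(3))
  from has_derivative_cong_nhds[OF ev2 this]
  have D: "(T.rep (tc c) (\<lambda>q. vertical_endo A q (X q)) has_derivative
     (\<lambda>h. (0, fst (fd (T.rep (tc c) X) (snd (tc c) p) h)))) (at (snd (tc c) p))" .
  show "T.diff_field (tc c) p (\<lambda>q. vertical_endo A q (X q))"
    unfolding T.diff_field_def using X'(1,2) differentiableI[OF D] ev1 by blast
  show "fd (T.rep (tc c) (\<lambda>q. vertical_endo A q (X q))) (snd (tc c) p) h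
      = (0, fst (fd (T.rep (tc c) X) (snd (tc c) p) h))"
    using fun_cong[OF fd_eqI[OF D]] .
qed

text \<open>In a chart \<open>J (a, b) = (0, a)\<close> has constant coefficients, and the derivative of the extension
  \<open>X\<close> enters \<open>[JX,Y]\<close> and \<open>J[X,Y]\<close> in the same way and cancels. What remains is the derivative of \<open>Y\<close>
  along \<open>J v\<close> minus \<open>J\<close> applied to the derivative of \<open>Y\<close> along \<open>v\<close>.\<close>

lemma J_bracket_chart:
  assumes Y: "T.diff_field (tc c) p Y" and c: "c \<in> A" and v: "v \<in> TTM p"
  shows "J_bracket A Y p v \<in> TTM p"
    and "J_bracket A Y p v (tc c) = fd (T.rep (tc c) Y) (snd (tc c) p) (0, fst (v (tc c)))
      - (0, fst (fd (T.rep (tc c) Y) (snd (tc c) p) (v (tc c))))"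
proof -
  note Y' = T.diff_fieldD[OF Y]
  note C = Y'(1,2)
  let ?z = "snd (tc c) p"
  define u where "u = fd (T.rep (tc c) Y) ?z (0, fst (v (tc c))) - (0, fst (fd (T.rep (tc c) Y) ?z (v (tc c))))"
  define z where "z = T.tangent_of (tc c) u p"
  have z: "z \<in> TTM p" "z (tc c) = u" using T.tangent_of_mem[OF C] C by (auto simp: z_def)
  have "J_bracket A Y p v = z"
    unfolding J_bracket_def
  proof (rule T.FN_bracket_eqI[OF C v])
    fix X assume X: "T.diff_field (tc c) p X" and Xp: "X p = v"
    note JX = diff_field_vertical_endo[OF X c]
    note b1 = T.lie_bracket_chart[OF JX(1) Y] and b2 = T.lie_bracket_chart[OF X Y]
    note Jb = vertical_endo_chart[OF c C(2) b2(1)]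
    show "z = lie_bracket (tangent_atlas A) (\<lambda>q. vertical_endo A q (X q)) Y p
        - vertical_endo A p (lie_bracket (tangent_atlas A) X Y p)"
    proof (rule T.tangent_eqI[OF z(1) T.tangent_diff[OF b1(1) Jb(1)] C])
      show "z (tc c) = (lie_bracket (tangent_atlas A) (\<lambda>q. vertical_endo A q (X q)) Y p
        - vertical_endo A p (lie_bracket (tangent_atlas A) X Y p)) (tc c)"
        using vertical_endo_chart(2)[OF c C(2) v]
        by (simp add: z(2) u_def b1(2) Jb(2) b2(2) JX(2) Xp)
    qed
  qed
  then show "J_bracket A Y p v \<in> TTM p"
    and "J_bracket A Y p v (tc c) = fd (T.rep (tc c) Y) ?z (0, fst (v (tc c)))
      - (0, fst (fd (T.rep (tc c) Y) ?z (v (tc c))))"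
    using z by (auto simp: u_def)
qed

lemma d_along_vertical_endo_chart:
  assumes c: "c \<in> A" "p \<in> fst (tc c)" and v: "v \<in> TTM p"
    and f: "(f \<circ> chart_inv (tc c)) differentiable (at (snd (tc c) p))"
  shows "d_along (tangent_atlas A) (vertical_endo A) f p v
    = fd (f \<circ> chart_inv (tc c)) (snd (tc c) p) (0, fst (v (tc c)))"
  unfolding d_along_def
  using T.differential_chart[OF tc_mem[OF c(1)] c(2) f vertical_endo_chart(1)[OF c v]]
    vertical_endo_chart(2)[OF c v] by simp

text \<open>The 1-form \<open>d\<^sub>J E\<close> sends \<open>Y\<close> to the derivative of \<open>E\<close> along \<open>J Y\<close>. Hence its exterior derivative is
  the difference of two iterated Lie derivatives and a bracket term, and the derivatives of the
  extensions cancel between them.\<close>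

lemma fundamental_form_chart:
  assumes c: "c \<in> A" "p \<in> fst (tc c)" and S: "open S" "snd (tc c) p \<in> S"
    and F: "Ck_on 2 S (E \<circ> chart_inv (tc c))" and v: "v \<in> TTM p" and w: "w \<in> TTM p"
  shows "fundamental_form A E p v w
    = D2 (E \<circ> chart_inv (tc c)) (snd (tc c) p) (v (tc c)) (0, fst (w (tc c)))
    - D2 (E \<circ> chart_inv (tc c)) (snd (tc c) p) (w (tc c)) (0, fst (v (tc c)))"
  unfolding fundamental_form_def
proof (rule T.ext_deriv_eqI[OF tc_mem[OF c(1)] c(2) v w])
  fix X Y assume X: "T.diff_field (tc c) p X" and Y: "T.diff_field (tc c) p Y"
    and XY: "X p = v" "Y p = w"
  let ?F = "E \<circ> chart_inv (tc c)" and ?z = "snd (tc c) p"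
  note dF = Ck_on_2D(1)[OF F S(2)]
  note JX = diff_field_vertical_endo[OF X c(1)] and JY = diff_field_vertical_endo[OF Y c(1)]
  note b = T.lie_bracket_chart[OF X Y]
  have \<theta>: "(\<lambda>q. d_along (tangent_atlas A) (vertical_endo A) E q (Z q))
      = lie_deriv (tangent_atlas A) (\<lambda>q. vertical_endo A q (Z q)) E" for Z
    by (simp add: d_along_def lie_deriv_def fun_eq_iff)
  have 1: "lie_deriv (tangent_atlas A) X (lie_deriv (tangent_atlas A) (\<lambda>q. vertical_endo A q (Y q)) E) p
    = D2 ?F ?z (v (tc c)) (0, fst (w (tc c))) + fd ?F ?z (0, fst (fd (T.rep (tc c) Y) ?z (v (tc c))))"
    using T.lie_deriv_lie_deriv[where X = X, OF _ JY(1) S F] XY v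
      vertical_endo_chart(2)[OF c w] JY(2) by simp
  have 2: "lie_deriv (tangent_atlas A) Y (lie_deriv (tangent_atlas A) (\<lambda>q. vertical_endo A q (X q)) E) p
    = D2 ?F ?z (w (tc c)) (0, fst (v (tc c))) + fd ?F ?z (0, fst (fd (T.rep (tc c) X) ?z (w (tc c))))"
    using T.lie_deriv_lie_deriv[where X = Y, OF _ JX(1) S F] XY w
      vertical_endo_chart(2)[OF c v] JX(2) by simp
  have 3: "d_along (tangent_atlas A) (vertical_endo A) E p (lie_bracket (tangent_atlas A) X Y p)
    = fd ?F ?z (0, fst (fd (T.rep (tc c) Y) ?z (v (tc c))))
      - fd ?F ?z (0, fst (fd (T.rep (tc c) X) ?z (w (tc c))))"
    using d_along_vertical_endo_chart[OF c b(1) dF] linear_diff[OF fd_linear[OF dF], symmetric]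
    by (simp add: b(2) XY)
  show "D2 ?F ?z (v (tc c)) (0, fst (w (tc c))) - D2 ?F ?z (w (tc c)) (0, fst (v (tc c)))
    = lie_deriv (tangent_atlas A) X (\<lambda>q. d_along (tangent_atlas A) (vertical_endo A) E q (Y q)) p
    - lie_deriv (tangent_atlas A) Y (\<lambda>q. d_along (tangent_atlas A) (vertical_endo A) E q (X q)) p
    - d_along (tangent_atlas A) (vertical_endo A) E p (lie_bracket (tangent_atlas A) X Y p)"
    unfolding \<theta> 1 2 3 by simp
qed

end

section \<open>Finsler manifolds\<close>

locale finsler = atlas_with_bundle A for A :: "('a, 'e::euclidean_space) chart set" +
  fixes E :: "('a, 'e) tpoint \<Rightarrow> real"
  assumes finsler: "finsler_manifold A E"
begin

definition slit :: "('a, 'e) chart \<Rightarrow> ('e \<times> 'e) set" where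
  "slit c = (snd c ` fst c) \<times> (- {0})"

abbreviation Ec :: "('a, 'e) chart \<Rightarrow> 'e \<times> 'e \<Rightarrow> real" where
  "Ec c \<equiv> E \<circ> chart_inv (tc c)"

lemma open_slit: "c \<in> A \<Longrightarrow> open (slit c)"
  unfolding slit_def by (intro open_Times open_chart) auto

lemma slit_image:
  assumes c: "c \<in> A"
  shows "snd (tc c) ` (slit_bundle A \<inter> fst (tc c)) = slit c"
proof (intro equalityI subsetI)
  fix z assume "z \<in> snd (tc c) ` (slit_bundle A \<inter> fst (tc c))"
  then obtain p where p: "p \<in> slit_bundle A" "p \<in> fst (tc c)" and z: "z = snd (tc c) p" by blast
  have "snd p c \<noteq> 0"
    using tangent_eqI[of "snd p" "fst p" 0 c] p c by (auto simp: slit_bundle_def tc_domain)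
  then show "z \<in> slit c" using p by (auto simp: z slit_def tc_apply tc_domain)
next
  fix z assume z: "z \<in> slit c"
  then have "z \<in> snd (tc c) ` fst (tc c)" unfolding tc_image[OF c] by (auto simp: slit_def)
  then obtain p where p: "p \<in> fst (tc c)" and zp: "z = snd (tc c) p" by blast
  have "snd p c \<noteq> 0" using z by (auto simp: zp tc_apply slit_def)
  then have "snd p \<noteq> 0" by auto
  then have "p \<in> slit_bundle A"
    using p c by (cases p) (auto simp: slit_bundle_def tangent_bundle_def tc_domain carrier_def)
  then show "z \<in> snd (tc c) ` (slit_bundle A \<inter> fst (tc c))" using p zp by blast
qed

lemma slit_point:
  assumes c: "c \<in> A" and z: "z \<in> slit c"
  shows "chart_inv (tc c) z \<in> slit_bundle A" "chart_inv (tc c) z \<in> fst (tc c)"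
    "snd (tc c) (chart_inv (tc c) z) = z"
proof -
  obtain p where "p \<in> slit_bundle A" "p \<in> fst (tc c)" "z = snd (tc c) p"
    using z unfolding slit_image[OF c, symmetric] by blast
  moreover from this have "chart_inv (tc c) z = p" using T.chart_inv_chart[OF tc_mem[OF c]] by simp
  ultimately show "chart_inv (tc c) z \<in> slit_bundle A" "chart_inv (tc c) z \<in> fst (tc c)"
    "snd (tc c) (chart_inv (tc c) z) = z" by auto
qed

lemma in_slit: "c \<in> A \<Longrightarrow> p \<in> slit_bundle A \<Longrightarrow> p \<in> fst (tc c) \<Longrightarrow> snd (tc c) p \<in> slit c"
  using slit_image by blast

lemma slit_bundle_chart:
  assumes "p \<in> slit_bundle A"
  obtains c where "c \<in> A" "p \<in> fst (tc c)"
  using assms by (cases p) (auto simp: slit_bundle_def tangent_bundle_def carrier_def tc_domain)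

lemma smooth_Ec:
  assumes c: "c \<in> A" shows "smooth_on (slit c) (Ec c)"
proof -
  have "smooth_fun (tangent_atlas A) (slit_bundle A) E"
    using finsler by (simp add: finsler_manifold_def)
  then show ?thesis
    using tc_mem[OF c] unfolding smooth_fun_def Ck_fun_def slit_image[OF c, symmetric] smooth_on_def
    by blast
qed

lemma Ck2_Ec: "c \<in> A \<Longrightarrow> Ck_on 2 (slit c) (Ec c)"
  using smooth_Ec unfolding smooth_on_def by blast

lemma smooth_diff_field:
  assumes c: "c \<in> A" and X: "\<And>q. q \<in> slit_bundle A \<Longrightarrow> X q \<in> TTM q"
    and sm: "smooth_on (slit c) (T.rep (tc c) X)"
    and p: "p \<in> slit_bundle A" "p \<in> fst (tc c)"
  shows "T.diff_field (tc c) p X"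
proof -
  have "\<forall>\<^sub>F z in nhds (snd (tc c) p). z \<in> slit c"
    by (rule eventually_nhds_in_open[OF open_slit[OF c] in_slit[OF c p]])
  then have "\<forall>\<^sub>F z in nhds (snd (tc c) p). X (chart_inv (tc c) z) \<in> TTM (chart_inv (tc c) z)"
    by eventually_elim (intro X slit_point c)
  then show ?thesis
    using smooth_on_differentiable[OF sm in_slit[OF c p]] tc_mem[OF c] p(2)
    by (simp add: T.diff_field_def)
qed

subsection \<open>The fundamental form in a chart\<close>

definition \<omega> :: "('a, 'e) chart \<Rightarrow> 'e \<times> 'e \<Rightarrow> 'e \<times> 'e \<Rightarrow> 'e \<times> 'e \<Rightarrow> real" where
  "\<omega> c z v w = D2 (Ec c) z v (0, fst w) - D2 (Ec c) z w (0, fst v)"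

lemma fundamental_form_slit:
  assumes "c \<in> A" "p \<in> slit_bundle A" "p \<in> fst (tc c)" "v \<in> TTM p" "w \<in> TTM p"
  shows "fundamental_form A E p v w = \<omega> c (snd (tc c) p) (v (tc c)) (w (tc c))"
  unfolding \<omega>_def using assms
  by (intro fundamental_form_chart[OF _ _ open_slit in_slit Ck2_Ec])

lemma linear_zero_Pair: "linear (\<lambda>w::'e \<times> 'e. (0::'e, fst w))"
  by (rule linearI) auto

context
  fixes c z
  assumes c: "c \<in> A" and z: "z \<in> slit c"
begin

lemma D2_sym: "D2 (Ec c) z u v = D2 (Ec c) z v u"
  by (rule D2_symmetric[OF open_slit[OF c] z Ck2_Ec[OF c]])

lemma D2_lin: "linear (D2 (Ec c) z u)"
  by (rule D2_linear_right[OF open_slit[OF c] z Ck2_Ec[OF c]])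

lemma fd_Ec_lin: "linear (fd (Ec c) z)"
  by (rule fd_linear[OF smooth_on_differentiable[OF smooth_Ec[OF c] z]])

lemma D2_lin_left: "linear (\<lambda>u. D2 (Ec c) z u v)"
  by (rule D2_linear_left[OF z Ck2_Ec[OF c]])

lemma \<omega>_linear_right: "linear (\<omega> c z v)"
  unfolding \<omega>_def[abs_def]
  using linear_compose_sub[OF linear_compose[OF linear_zero_Pair D2_lin] D2_lin_left]
  by (simp add: o_def)

lemma \<omega>_linear_left: "linear (\<lambda>v. \<omega> c z v w)"
  unfolding \<omega>_def[abs_def]
  using linear_compose_sub[OF D2_lin_left linear_compose[OF linear_zero_Pair D2_lin]]
  by (simp add: o_def)

lemma \<omega>_nondegenerate:
  assumes "\<And>w. \<omega> c z v w = 0" shows "v = 0"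
proof -
  let ?p = "chart_inv (tc c) z"
  note p = slit_point[OF c z]
  have v: "T.tangent_of (tc c) v ?p \<in> TTM ?p" "T.tangent_of (tc c) v ?p (tc c) = v"
    using T.tangent_of_mem[OF tc_mem[OF c] p(2)] tc_mem[OF c] p(2) by auto
  have "fundamental_form A E ?p (T.tangent_of (tc c) v ?p) w = 0" if "w \<in> TTM ?p" for w
    using fundamental_form_slit[OF c p(1,2) v(1) that] assms v(2) p(3) by simp
  then have "T.tangent_of (tc c) v ?p = 0"
    using finsler p(1) v(1) unfolding finsler_manifold_def by blast
  then show ?thesis using v(2) by simp
qed

lemma \<omega>_vertical_left: "\<omega> c z (0, b) w = D2 (Ec c) z (0, b) (0, fst w)"
  using linear_0[OF D2_lin] by (simp add: \<omega>_def zero_prod_def)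

lemma \<omega>_vertical_right: "\<omega> c z v (0, b) = - D2 (Ec c) z (0, b) (0, fst v)"
  using linear_0[OF D2_lin] by (simp add: \<omega>_def zero_prod_def)

text \<open>Nondegeneracy of the fundamental form tested on vertical vectors: the Hessian of \<open>E\<close> along the
  fibres is nondegenerate. It is the tool for proving that a component is zero.\<close>

lemma vertical_hessian_nondegenerate:
  assumes "\<And>a. D2 (Ec c) z (0, a) (0, b) = 0" shows "b = 0"
proof -
  have "(0::'e, b) = 0"
    by (rule \<omega>_nondegenerate) (simp add: \<omega>_vertical_left D2_sym[of "(0, b)"] assms)
  then show ?thesis by (simp add: zero_prod_def)
qed

end

text \<open>The coordinate vector of the functional \<open>\<omega>(v, -)\<close>. It turns the equation defining the sharp into
  a linear system with an injective coefficient map.\<close>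

definition \<omega>_map :: "('a, 'e) chart \<Rightarrow> 'e \<times> 'e \<Rightarrow> 'e \<times> 'e \<Rightarrow> 'e \<times> 'e" where
  "\<omega>_map c z v = (\<Sum>i\<in>Basis. \<omega> c z v i *\<^sub>R i)"

lemma \<omega>_map_eq_iff:
  assumes c: "c \<in> A" and z: "z \<in> slit c" and b: "linear b"
  shows "\<omega>_map c z v = (\<Sum>i\<in>Basis. b i *\<^sub>R i) \<longleftrightarrow> (\<forall>w. \<omega> c z v w = b w)"
proof
  assume eq: "\<omega>_map c z v = (\<Sum>i\<in>Basis. b i *\<^sub>R i)"
  have "\<omega> c z v i = b i" if i: "i \<in> Basis" for i
    using arg_cong[OF eq, of "\<lambda>x. x \<bullet> i"] i by (simp add: \<omega>_map_def)
  then show "\<forall>w. \<omega> c z v w = b w"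
    using linear_eq_stdbasis[OF \<omega>_linear_right[OF c z] b] by blast
next
  assume "\<forall>w. \<omega> c z v w = b w"
  then have "\<omega> c z v = b" by blast
  then show "\<omega>_map c z v = (\<Sum>i\<in>Basis. b i *\<^sub>R i)" by (simp add: \<omega>_map_def)
qed

lemma \<omega>_map_linear:
  assumes c: "c \<in> A" and z: "z \<in> slit c"
  shows "linear (\<omega>_map c z)"
  by (intro linearI) (simp_all add: \<omega>_map_def linear_add[OF \<omega>_linear_left[OF c z]]
      linear_scale[OF \<omega>_linear_left[OF c z]] scaleR_left_distrib sum.distrib scaleR_sum_right)

lemma \<omega>_map_inj:
  assumes c: "c \<in> A" and z: "z \<in> slit c"
  shows "inj (\<omega>_map c z)"
proof -
  have "v = 0" if "\<omega>_map c z v = 0" for v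
  proof (rule \<omega>_nondegenerate[OF c z])
    have "\<omega>_map c z v = (\<Sum>i\<in>Basis. 0 *\<^sub>R i)" using that by simp
    from iffD1[OF \<omega>_map_eq_iff[OF c z linear_zero] this]
    show "\<omega> c z v w = 0" for w by blast
  qed
  then show ?thesis using linear_injective_0[OF \<omega>_map_linear[OF c z]] by blast
qed

lemma sharp_chart:
  assumes c: "c \<in> A" and p: "p \<in> slit_bundle A" "p \<in> fst (tc c)"
    and b: "linear b" and \<beta>: "\<And>w. w \<in> TTM p \<Longrightarrow> \<beta> p w = b (w (tc c))"
  shows "sharp A E \<beta> p \<in> TTM p" "\<omega> c (snd (tc c) p) (sharp A E \<beta> p (tc c)) w = b w"
proof -
  let ?z = "snd (tc c) p"
  note C = tc_mem[OF c] p(2) and z = in_slit[OF c p]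
  let ?P = "\<lambda>v. v \<in> TTM p \<and> (\<forall>w\<in>TTM p. fundamental_form A E p v w = \<beta> p w)"
  have "surj (\<omega>_map c ?z)"
    by (rule linear_injective_imp_surjective[OF \<omega>_map_linear[OF c z] \<omega>_map_inj[OF c z]])
      simp
  then obtain s where "(\<Sum>i\<in>Basis. b i *\<^sub>R i) = \<omega>_map c ?z s" by (rule surjE)
  from iffD1[OF \<omega>_map_eq_iff[OF c z b] this[symmetric]]
  have s: "\<omega> c ?z s w = b w" for w by blast
  define v where "v = T.tangent_of (tc c) s p"
  have v: "v \<in> TTM p" "v (tc c) = s" using T.tangent_of_mem[OF C] C by (auto simp: v_def)
  have "?P v"
    using v fundamental_form_slit[OF c p v(1)] s \<beta> by auto
  moreover have "v' = v" if v': "?P v'" for v'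
  proof -
    from v' have v'T: "v' \<in> TTM p" by blast
    have "\<omega> c ?z (v' (tc c) - s) w = 0" for w
    proof -
      have w: "T.tangent_of (tc c) w p \<in> TTM p" "T.tangent_of (tc c) w p (tc c) = w"
        using T.tangent_of_mem[OF C] C by auto
      have "\<omega> c ?z (v' (tc c)) w = b w"
        using v' w fundamental_form_slit[OF c p v'T w(1)] \<beta>[OF w(1)] by simp
      then show ?thesis using s[of w] linear_diff[OF \<omega>_linear_left[OF c z]] by simp
    qed
    then have "v' (tc c) - s = 0" by (rule \<omega>_nondegenerate[OF c z])
    then show ?thesis using T.tangent_eqI[OF v'T v(1) C] v(2) by simp
  qed
  ultimately have "sharp A E \<beta> p = v" unfolding sharp_def by (rule the_equality)
  then show "sharp A E \<beta> p \<in> TTM p" "\<omega> c (snd (tc c) p) (sharp A E \<beta> p (tc c)) w = b w"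
    using v s by auto
qed

lemma smooth_sharp:
  assumes c: "c \<in> A"
    and b: "\<And>z. z \<in> slit c \<Longrightarrow> linear (b z)" "\<And>w. smooth_on (slit c) (\<lambda>z. b z w)"
    and \<beta>: "\<And>p w. p \<in> slit_bundle A \<Longrightarrow> p \<in> fst (tc c) \<Longrightarrow> w \<in> TTM p \<Longrightarrow>
      \<beta> p w = b (snd (tc c) p) (w (tc c))"
  shows "smooth_on (slit c) (T.rep (tc c) (sharp A E \<beta>))"
proof (rule smooth_on_linear_solution[OF open_slit[OF c] \<omega>_map_linear[OF c] \<omega>_map_inj[OF c]])
  have basis_sum: "smooth_on (slit c) (\<lambda>z. \<Sum>i\<in>Basis. g i z *\<^sub>R i)"
    if "\<And>i. smooth_on (slit c) (g i)" for g :: "'e \<times> 'e \<Rightarrow> 'e \<times> 'e \<Rightarrow> real"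
    by (rule smooth_on_sum[OF open_slit[OF c] smooth_on_scaleR[OF open_slit[OF c] that
            smooth_on_const]])
  show "smooth_on (slit c) (\<lambda>z. \<Sum>i\<in>Basis. b z i *\<^sub>R i)"
    by (rule basis_sum[OF b(2)])
  show "smooth_on (slit c) (\<lambda>z. \<omega>_map c z v)" for v
    unfolding \<omega>_map_def
  proof (rule basis_sum)
    show "smooth_on (slit c) (\<lambda>z. \<omega> c z v i)" for i
      unfolding \<omega>_def D2_def
      by (intro smooth_on_diff[OF open_slit[OF c]] smooth_on_fd smooth_Ec c)
  qed
  show "\<omega>_map c z (T.rep (tc c) (sharp A E \<beta>) z) = (\<Sum>i\<in>Basis. b z i *\<^sub>R i)"
    if z: "z \<in> slit c" for z
    using sharp_chart(2)[OF c slit_point(1,2)[OF c z] b(1)[OF z], of \<beta>]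
      \<beta>[OF slit_point(1,2)[OF c z]] slit_point(3)[OF c z] \<omega>_map_eq_iff[OF c z b(1)[OF z]] by simp
qed

subsection \<open>The canonical spray and the Berwald connection\<close>

lemma differential_E_chart:
  assumes "c \<in> A" "p \<in> slit_bundle A" "p \<in> fst (tc c)" "w \<in> TTM p"
  shows "differential (tangent_atlas A) E p w = fd (Ec c) (snd (tc c) p) (w (tc c))"
  by (rule T.differential_chart[OF tc_mem[OF assms(1)] assms(3)
        smooth_on_differentiable[OF smooth_Ec[OF assms(1)] in_slit[OF assms(1-3)]] assms(4)])

text \<open>Euler's identity for a function that is homogeneous of degree 2 in the fibre variable.\<close>

lemma euler_Ec:
  assumes c: "c \<in> A" and z: "z \<in> slit c"
  shows "fd (Ec c) z (0, snd z) = 2 * Ec c z"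
proof -
  let ?p = "chart_inv (tc c) z"
  note p = slit_point[OF c z]
  have "lie_deriv (tangent_atlas A) (liouville A) E ?p = 2 * E ?p"
    using finsler p(1) by (simp add: finsler_manifold_def slit_bundle_def)
  moreover have "snd ?p c = snd z" using arg_cong[OF p(3), of snd] by (simp add: tc_apply)
  ultimately show ?thesis
    using differential_E_chart[OF c p(1,2) liouville_chart(1)[OF c p(2)]]
      liouville_chart(2)[OF c p(2)] p(3) by (simp add: lie_deriv_def)
qed

lemma euler_D2_Ec:
  assumes c: "c \<in> A" and z: "z \<in> slit c"
  shows "D2 (Ec c) z h (0, snd z) + fd (Ec c) z (0, snd h) = 2 * fd (Ec c) z h"
proof -
  have "((\<lambda>z. (0::'e, snd z :: 'e)) has_derivative (\<lambda>h. (0, snd h))) (at z)"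
    by (intro derivative_intros)
  note D = has_derivative_fd_apply[OF open_slit[OF c] z Ck2_Ec[OF c] this]
  have "((\<lambda>z. 2 * Ec c z) has_derivative (\<lambda>h. 2 * fd (Ec c) z h)) (at z)"
    by (intro has_derivative_mult_right fd_works smooth_on_differentiable[OF smooth_Ec[OF c] z])
  then have "((\<lambda>z. fd (Ec c) z (0, snd z)) has_derivative (\<lambda>h. 2 * fd (Ec c) z h)) (at z)"
    by (rule has_derivative_transform_within_open[OF _ open_slit[OF c] z]) (simp add: euler_Ec[OF c])
  from fun_cong[OF has_derivative_unique[OF D this], of h] show ?thesis by simp
qed

lemma spray_tangent: "p \<in> slit_bundle A \<Longrightarrow> canonical_spray A E p \<in> TTM p"
  and spray_chart: "c \<in> A \<Longrightarrow> z \<in> slit c \<Longrightarrow>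
      \<omega> c z (T.rep (tc c) (canonical_spray A E) z) w = - fd (Ec c) z w"
  and smooth_spray: "c \<in> A \<Longrightarrow> smooth_on (slit c) (T.rep (tc c) (canonical_spray A E))"
proof -
  let ?dE = "differential (tangent_atlas A) E"
  have S: "canonical_spray A E p = - sharp A E ?dE p" if "p \<in> slit_bundle A" for p
    using that by (simp add: canonical_spray_def)
  have sharp: "sharp A E ?dE p \<in> TTM p"
    "\<omega> c (snd (tc c) p) (sharp A E ?dE p (tc c)) w = fd (Ec c) (snd (tc c) p) w"
    if "c \<in> A" "p \<in> slit_bundle A" "p \<in> fst (tc c)" for c p w
    using sharp_chart[OF that fd_Ec_lin[OF that(1) in_slit[OF that]], of ?dE]
      differential_E_chart[OF that] by blast+
  show "canonical_spray A E p \<in> TTM p" if p: "p \<in> slit_bundle A"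
    by (rule slit_bundle_chart[OF p]) (simp add: S[OF p] T.tangent_minus sharp(1)[OF _ p])
  show "\<omega> c z (T.rep (tc c) (canonical_spray A E) z) w = - fd (Ec c) z w"
    if c: "c \<in> A" and z: "z \<in> slit c"
    using sharp(2)[OF c slit_point(1,2)[OF c z], of w] slit_point(3)[OF c z]
      linear_neg[OF \<omega>_linear_left[OF c z]] S[OF slit_point(1)[OF c z]] by simp
  show "smooth_on (slit c) (T.rep (tc c) (canonical_spray A E))" if c: "c \<in> A"
  proof -
    have "smooth_on (slit c) (T.rep (tc c) (sharp A E ?dE))"
      using fd_Ec_lin[OF c] smooth_on_fd[OF smooth_Ec[OF c]] differential_E_chart[OF c]
      by (rule smooth_sharp[OF c])
    from smooth_on_linear[OF open_slit[OF c] bounded_linear_minus[OF bounded_linear_ident] this]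
    show ?thesis
      by (rule smooth_on_transform[OF _ open_slit[OF c]]) (simp add: S[OF slit_point(1)[OF c]])
  qed
qed

text \<open>The first identity says that the spray is a second-order field. It follows by comparing
  the vertical part of \<open>i\<^sub>S \<omega> = - dE\<close> with Euler's identity and using nondegeneracy of the vertical
  Hessian. The horizontal part then gives \<open>D2 E (S, (0, a)) = dE (a, 0)\<close>. Finally \<open>S E = - \<omega>(S, S) = 0\<close>,
  and differentiating this along the fibre gives the second identity.\<close>

lemma canonical_spray_identities:
  fixes c z defines "s \<equiv> T.rep (tc c) (canonical_spray A E)"
  assumes c: "c \<in> A" and z: "z \<in> slit c"
  shows "fst (s z) = snd z" "fd (Ec c) z (fd s z (0, a)) = - fd (Ec c) z (a, 0)"
proof -
  let ?D = "D2 (Ec c) z" and ?d = "fd (Ec c) z"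
  note lin = D2_lin[OF c z] D2_lin_left[OF c z] fd_Ec_lin[OF c z]
  have spray: "\<omega> c z (s z) w = - ?d w" for w
    unfolding s_def by (rule spray_chart[OF c z])
  have "?D (0, b) (0, fst (s z) - snd z) = 0" for b
  proof -
    have "?D (0, b) (0, fst (s z)) = ?d (0, b)"
      using spray[of "(0, b)"] \<omega>_vertical_right[OF c z] by simp
    moreover have "?D (0, b) (0, snd z) = ?d (0, b)" using euler_D2_Ec[OF c z, of "(0, b)"] by simp
    moreover have "(0, fst (s z) - snd z) = (0, fst (s z)) - (0::'e, snd z)" by simp
    ultimately show ?thesis by (simp only: linear_diff[OF lin(1)])
  qed
  then show fst_s: "fst (s z) = snd z"
    using vertical_hessian_nondegenerate[OF c z, of "fst (s z) - snd z"] by simp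
  have "?D (s z) (0, a) - ?D (a, 0) (0, fst (s z)) = - ?d (a, 0)"
    using spray[of "(a, 0)"] by (simp add: \<omega>_def)
  moreover have "?D (a, 0) (0, snd z) = 2 * ?d (a, 0)"
    using euler_D2_Ec[OF c z, of "(a, 0)"] linear_0[OF lin(3)] by (simp add: zero_prod_def)
  ultimately have s1: "?D (s z) (0, a) = ?d (a, 0)" using fst_s by simp
  \<comment> \<open>S is tangent to the level sets of E because the 2-form is alternating.\<close>
  have zero: "fd (Ec c) y (s y) = 0" if "y \<in> slit c" for y
    using spray_chart[OF c that, of "s y"] by (simp add: \<omega>_def s_def)
  have s': "(s has_derivative fd s z) (at z)"
    using smooth_spray[OF c] z unfolding s_def by (intro fd_works smooth_on_differentiable)
  from has_derivative_fd_apply[OF open_slit[OF c] z Ck2_Ec[OF c] this]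
  have "((\<lambda>_. 0) has_derivative (\<lambda>h. ?D h (s z) + ?d (fd s z h))) (at z)"
    by (rule has_derivative_transform_within_open[OF _ open_slit[OF c] z]) (simp add: zero)
  from fun_cong[OF has_derivative_unique[OF this has_derivative_const]]
  have "?D h (s z) + ?d (fd s z h) = 0" for h .
  from this[of "(0, a)"] show "?d (fd s z (0, a)) = - ?d (a, 0)"
    using s1 D2_sym[OF c z] by simp
qed

text \<open>The Berwald connection is conservative. For \<open>v = (a, b)\<close> the chart expression of \<open>[J,S] v\<close> is the
  derivative of \<open>S\<close> along \<open>(0, a)\<close> minus \<open>(0, b)\<close>, and its image under \<open>dE\<close> is \<open>- dE (a, b)\<close>.\<close>

lemma berwald_connection_annihilates_E:
  assumes c: "c \<in> A" and p: "p \<in> slit_bundle A" "p \<in> fst (tc c)" and v: "v \<in> TTM p"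
  shows "berwald_connection A E p v \<in> TTM p"
    and "fd (Ec c) (snd (tc c) p) (berwald_connection A E p v (tc c)) = 0"
proof -
  let ?z = "snd (tc c) p"
  define s where "s = T.rep (tc c) (canonical_spray A E)"
  note z = in_slit[OF c p] and C = tc_mem[OF c] p(2)
  note D = smooth_diff_field[OF c spray_tangent smooth_spray[OF c] p]
  note J = J_bracket_chart[OF D c v, folded s_def]
  note B = canonical_spray_identities[OF c, folded s_def]
  show "berwald_connection A E p v \<in> TTM p"
    unfolding berwald_connection_def by (intro T.tangent_vscale T.tangent_add v J(1))
  have "(s has_derivative fd s ?z) (at ?z)"
    using T.diff_fieldD(3)[OF D] unfolding s_def by (rule fd_works)
  from has_derivative_fst[OF this]
  have "(snd has_derivative (\<lambda>h. fst (fd s ?z h))) (at ?z)"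
    by (rule has_derivative_transform_within_open[OF _ open_slit[OF c] z]) (simp add: s_def B(1))
  moreover have "(snd has_derivative snd) (at ?z)"
    by (rule bounded_linear_imp_has_derivative[OF bounded_linear_snd])
  ultimately have "(\<lambda>h. fst (fd s ?z h)) = snd" by (rule has_derivative_unique)
  then have fst_s: "fst (fd s ?z h) = snd h" for h by (rule fun_cong)
  note lin = fd_Ec_lin[OF c z]
  obtain a b where ab: "v (tc c) = (a, b)" by (cases "v (tc c)")
  have "fd (Ec c) ?z (a, b) = fd (Ec c) ?z ((a, 0) + (0, b))" by simp
  also have "\<dots> = fd (Ec c) ?z (a, 0) + fd (Ec c) ?z (0, b)" by (rule linear_add[OF lin])
  finally show "fd (Ec c) ?z (berwald_connection A E p v (tc c)) = 0"
    using B(2)[OF z, of a]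
    by (simp add: berwald_connection_def vscale_def J(2) fst_s ab linear_scale[OF lin]
        linear_add[OF lin] linear_diff[OF lin])
qed

subsection \<open>Vertical fields over the slit bundle\<close>

lemma vertical_fieldI:
  assumes "\<And>p. p \<in> slit_bundle A \<Longrightarrow> X p \<in> TTM p"
    and "\<And>c. c \<in> A \<Longrightarrow> smooth_on (slit c) (T.rep (tc c) X)"
    and "\<And>c p. c \<in> A \<Longrightarrow> p \<in> slit_bundle A \<Longrightarrow> p \<in> fst (tc c) \<Longrightarrow> fst (X p (tc c)) = 0"
  shows "vertical_field A (slit_bundle A) X"
  unfolding vertical_field_def vector_field_def
proof (intro conjI ballI assms(1))
  fix C assume "C \<in> tangent_atlas A"
  then obtain c where c: "c \<in> A" "C = tc c" by (auto simp: tangent_atlas_def)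
  show "smooth_on (snd C ` (slit_bundle A \<inter> fst C)) (T.rep C X)"
    unfolding c(2) slit_image[OF c(1)] by (rule assms(2)[OF c(1)])
next
  fix p assume p: "p \<in> slit_bundle A"
  obtain c where c: "c \<in> A" "p \<in> fst (tc c)" using slit_bundle_chart[OF p] .
  show "proj_map A p (X p) = 0"
    using proj_map_eq_0_iff[OF c assms(1)[OF p]] assms(3)[OF c(1) p c(2)] by blast
qed

lemma vertical_fieldD:
  assumes X: "vertical_field A (slit_bundle A) X"
  shows "p \<in> slit_bundle A \<Longrightarrow> X p \<in> TTM p"
    and "c \<in> A \<Longrightarrow> smooth_on (slit c) (T.rep (tc c) X)"
    and "c \<in> A \<Longrightarrow> p \<in> slit_bundle A \<Longrightarrow> p \<in> fst (tc c) \<Longrightarrow> fst (X p (tc c)) = 0"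
    and "c \<in> A \<Longrightarrow> p \<in> slit_bundle A \<Longrightarrow> p \<in> fst (tc c) \<Longrightarrow> T.diff_field (tc c) p X"
proof -
  show 1: "X p \<in> TTM p" if "p \<in> slit_bundle A" for p
    using X that by (simp add: vertical_field_def vector_field_def)
  show 2: "smooth_on (slit c) (T.rep (tc c) X)" if c: "c \<in> A"
    using X tc_mem[OF c] unfolding vertical_field_def vector_field_def slit_image[OF c, symmetric]
    by blast
  show "fst (X p (tc c)) = 0" if "c \<in> A" "p \<in> slit_bundle A" "p \<in> fst (tc c)"
    using X proj_map_eq_0_iff[OF that(1,3) 1[OF that(2)]] that(2) by (simp add: vertical_field_def)
  show "T.diff_field (tc c) p X" if c: "c \<in> A" and p: "p \<in> slit_bundle A" "p \<in> fst (tc c)"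
    by (rule smooth_diff_field[OF c 1 2[OF c] p])
qed

lemma vertical_field_add:
  assumes X: "vertical_field A (slit_bundle A) X" and Y: "vertical_field A (slit_bundle A) Y"
  shows "vertical_field A (slit_bundle A) (X + Y)"
proof (rule vertical_fieldI)
  show "(X + Y) p \<in> TTM p" if "p \<in> slit_bundle A" for p
    using T.tangent_add[OF vertical_fieldD(1)[OF X that] vertical_fieldD(1)[OF Y that]] by simp
  show "smooth_on (slit c) (T.rep (tc c) (X + Y))" if c: "c \<in> A" for c
    using smooth_on_add[OF open_slit[OF c] vertical_fieldD(2)[OF X c] vertical_fieldD(2)[OF Y c]]
    by simp
  show "fst ((X + Y) p (tc c)) = 0" if "c \<in> A" "p \<in> slit_bundle A" "p \<in> fst (tc c)" for c p
    using vertical_fieldD(3)[OF X that] vertical_fieldD(3)[OF Y that] by simp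
qed

lemma vertical_field_subset:
  assumes "vertical_field A (tangent_bundle A) X"
  shows "vertical_field A (slit_bundle A) X"
  unfolding vertical_field_def vector_field_def
proof (intro conjI ballI)
  have sub: "slit_bundle A \<subseteq> tangent_bundle A" by (auto simp: slit_bundle_def)
  show "X p \<in> TTM p" "proj_map A p (X p) = 0" if "p \<in> slit_bundle A" for p
    using assms sub that by (auto simp: vertical_field_def vector_field_def)
  show "smooth_on (snd C ` (slit_bundle A \<inter> fst C)) (T.rep C X)" if "C \<in> tangent_atlas A" for C
  proof (rule smooth_on_subset)
    show "smooth_on (snd C ` (tangent_bundle A \<inter> fst C)) (T.rep C X)"
      using assms that unfolding vertical_field_def vector_field_def by blast
  qed (use sub in blast)
qed

text \<open>The base components of a vertical field are constantly zero, so the second term of the chart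
  expression of \<open>[J,X]\<close> disappears.\<close>

lemma J_bracket_vertical:
  assumes X: "vertical_field A (slit_bundle A) X"
    and c: "c \<in> A" and p: "p \<in> slit_bundle A" "p \<in> fst (tc c)" and v: "v \<in> TTM p"
  shows "J_bracket A X p v \<in> TTM p"
    and "J_bracket A X p v (tc c) = fd (T.rep (tc c) X) (snd (tc c) p) (0, fst (v (tc c)))"
proof -
  let ?z = "snd (tc c) p"
  note D = vertical_fieldD(4)[OF X c p]
  note J = J_bracket_chart[OF D c v]
  show "J_bracket A X p v \<in> TTM p" by (rule J(1))
  from has_derivative_fst[OF fd_works[OF T.diff_fieldD(3)[OF D]]]
  have "((\<lambda>_. 0) has_derivative (\<lambda>h. fst (fd (T.rep (tc c) X) ?z h))) (at ?z)"
    by (rule has_derivative_transform_within_open[OF _ open_slit[OF c] in_slit[OF c p]])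
      (rule vertical_fieldD(3)[OF X c slit_point(1,2)[OF c]])
  from fun_cong[OF has_derivative_unique[OF this has_derivative_const]]
  have "fst (fd (T.rep (tc c) X) ?z h) = 0" for h .
  then show "J_bracket A X p v (tc c) = fd (T.rep (tc c) X) ?z (0, fst (v (tc c)))"
    by (simp add: J(2) zero_prod_def[symmetric])
qed

text \<open>The 1-form \<open>dE \<circ> [J,V]\<close> vanishes on vertical vectors, since \<open>[J,V]\<close> is semibasic. By
  nondegeneracy of the vertical Hessian its sharp is therefore vertical.\<close>

lemma vertical_field_sharp:
  assumes V: "vertical_field A (slit_bundle A) V"
  shows "vertical_field A (slit_bundle A)
    (sharp A E (d_along (tangent_atlas A) (J_bracket A V) E))"
proof -
  let ?\<beta> = "d_along (tangent_atlas A) (J_bracket A V) E"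
  define b where "b = (\<lambda>c z w. fd (Ec c) z (fd (T.rep (tc c) V) z (0::'e, fst (w :: 'e \<times> 'e))))"
  have dV: "T.rep (tc c) V differentiable (at z)" if "c \<in> A" "z \<in> slit c" for c z
    by (rule smooth_on_differentiable[OF vertical_fieldD(2)[OF V that(1)] that(2)])
  have lin: "linear (b c z)" if c: "c \<in> A" and z: "z \<in> slit c" for c z
    using linear_compose[OF linear_zero_Pair
        linear_compose[OF fd_linear[OF dV[OF c z]] fd_Ec_lin[OF c z]]]
    by (simp add: b_def[abs_def] o_def)
  have \<beta>: "?\<beta> p w = b c (snd (tc c) p) (w (tc c))"
    if c: "c \<in> A" and p: "p \<in> slit_bundle A" "p \<in> fst (tc c)" and w: "w \<in> TTM p" for c p w
    using differential_E_chart[OF c p J_bracket_vertical(1)[OF V c p w]]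
      J_bracket_vertical(2)[OF V c p w] by (simp add: d_along_def b_def)
  show ?thesis
  proof (rule vertical_fieldI)
    fix p assume p: "p \<in> slit_bundle A"
    obtain c where c: "c \<in> A" "p \<in> fst (tc c)" using slit_bundle_chart[OF p] .
    show "sharp A E ?\<beta> p \<in> TTM p"
      by (rule sharp_chart(1)[where \<beta> = ?\<beta>, OF c(1) p c(2) lin[OF c(1) in_slit[OF c(1) p c(2)]] \<beta>[OF c(1) p c(2)]])
  next
    fix c assume c: "c \<in> A"
    show "smooth_on (slit c) (T.rep (tc c) (sharp A E ?\<beta>))"
    proof (rule smooth_sharp[where \<beta> = ?\<beta>, OF c lin[OF c] _ \<beta>[OF c]])
      show "smooth_on (slit c) (\<lambda>z. b c z w)" for w
        unfolding b_def
        by (rule smooth_on_fd_apply[OF open_slit[OF c] smooth_Ec[OF c]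
              smooth_on_fd[OF vertical_fieldD(2)[OF V c]]])
    qed
  next
    fix c p assume c: "c \<in> A" and p: "p \<in> slit_bundle A" "p \<in> fst (tc c)"
    let ?z = "snd (tc c) p" and ?W = "sharp A E ?\<beta> p (tc c)"
    note z = in_slit[OF c p]
    have "D2 (Ec c) ?z (0, a) (0, fst ?W) = 0" for a
    proof -
      have "fd (T.rep (tc c) V) ?z (0, 0) = 0"
        using linear_0[OF fd_linear[OF dV[OF c z]]] by (simp add: zero_prod_def)
      then have "b c ?z (0, a) = 0" using linear_0[OF fd_Ec_lin[OF c z]] by (simp add: b_def)
      then show ?thesis
        using sharp_chart(2)[where \<beta> = ?\<beta>, OF c p lin[OF c z] \<beta>[OF c p], of "(0, a)"]
          \<omega>_vertical_right[OF c z] by simp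
    qed
    then show "fst ?W = 0" by (rule vertical_hessian_nondegenerate[OF c z])
  qed
qed

text \<open>For vertical \<open>U\<close> the product rule gives \<open>d\<^sub>J (U E) (v) = D2 E (J v, U) + dE ([J,U] v)\<close>, while
  \<open>\<omega>(U, v) = D2 E (U, J v)\<close>. By symmetry of second derivatives the two agree exactly when
  \<open>dE \<circ> [J,U]\<close> is zero.\<close>

lemma conservative_fieldI:
  assumes U: "vertical_field A (slit_bundle A) U"
    and J: "\<And>p v. p \<in> slit_bundle A \<Longrightarrow> v \<in> TTM p \<Longrightarrow>
      d_along (tangent_atlas A) (J_bracket A U) E p v = 0"
  shows "conservative_field A E U"
  unfolding conservative_field_def
proof (intro conjI ballI U)
  fix p v assume p: "p \<in> slit_bundle A" and v: "v \<in> TTM p"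
  obtain c where c: "c \<in> A" "p \<in> fst (tc c)" using slit_bundle_chart[OF p] .
  let ?z = "snd (tc c) p" and ?u = "U p (tc c)" and ?a = "(0, fst (v (tc c)))"
  note z = in_slit[OF c(1) p c(2)]
  note Up = vertical_fieldD(1)[OF U p] and Ju = J_bracket_vertical[OF U c(1) p c(2) v]
  obtain b where b: "?u = (0, b)"
    using vertical_fieldD(3)[OF U c(1) p c(2)] by (cases ?u) auto
  have 1: "fundamental_form A E p (U p) v = D2 (Ec c) ?z ?u ?a"
    using fundamental_form_slit[OF c(1) p c(2) Up v] \<omega>_vertical_left[OF c(1) z] b by simp
  have 2: "fd (Ec c) ?z (fd (T.rep (tc c) U) ?z ?a) = 0"
    using J[OF p v] differential_E_chart[OF c(1) p c(2) Ju(1)] Ju(2) by (simp add: d_along_def)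
  note D = T.has_derivative_lie_deriv[OF vertical_fieldD(4)[OF U c(1) p c(2)] open_slit[OF c(1)] z
      Ck2_Ec[OF c(1)]]
  have "d_along (tangent_atlas A) (vertical_endo A) (lie_deriv (tangent_atlas A) U E) p v
      = D2 (Ec c) ?z ?a ?u"
    using d_along_vertical_endo_chart[OF c v differentiableI[OF D]] fun_cong[OF fd_eqI[OF D], of ?a] 2
    by simp
  then show "fundamental_form A E p (U p) v
      = d_along (tangent_atlas A) (vertical_endo A) (lie_deriv (tangent_atlas A) U E) p v"
    using 1 D2_sym[OF c(1) z] by simp
qed

text \<open>The bracket with \<open>J\<close> is additive, so with \<open>W\<close> the sharp of \<open>dE \<circ> [J,V]\<close> the connection is
  the Berwald connection plus \<open>[J, V + W]\<close>. The Berwald part does not contribute to the derivative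
  of \<open>E\<close>.\<close>

lemma conservative_L_connection:
  assumes V: "vertical_field A (slit_bundle A) V"
    and cons: "conservative_connection A E (L_connection A E (J_bracket A V))"
  shows "conservative_field A E
    (V + sharp A E (d_along (tangent_atlas A) (J_bracket A V) E))"
proof -
  define W where "W = sharp A E (d_along (tangent_atlas A) (J_bracket A V) E)"
  have W: "vertical_field A (slit_bundle A) W" unfolding W_def by (rule vertical_field_sharp[OF V])
  note U = vertical_field_add[OF V W]
  show ?thesis
    unfolding W_def[symmetric]
  proof (rule conservative_fieldI[OF U])
    fix p v assume p: "p \<in> slit_bundle A" and v: "v \<in> TTM p"
    obtain c where c: "c \<in> A" "p \<in> fst (tc c)" using slit_bundle_chart[OF p] .
    let ?z = "snd (tc c) p" and ?h = "L_connection A E (J_bracket A V) p v"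
    note z = in_slit[OF c(1) p c(2)]
    note JV = J_bracket_vertical[OF V c(1) p c(2) v] and JW = J_bracket_vertical[OF W c(1) p c(2) v]
      and JU = J_bracket_vertical[OF U c(1) p c(2) v]
      and B = berwald_connection_annihilates_E[OF c(1) p c(2) v]
    note lin = fd_Ec_lin[OF c(1) z]
    have h: "?h = berwald_connection A E p v + J_bracket A V p v + J_bracket A W p v"
      by (simp add: L_connection_def W_def)
    have hT: "?h \<in> TTM p" unfolding h by (intro T.tangent_add B(1) JV(1) JW(1))
    have "fd (Ec c) ?z (?h (tc c)) = 0"
      using cons p v differential_E_chart[OF c(1) p c(2) hT]
      by (simp add: conservative_connection_def d_along_def)
    then have "fd (Ec c) ?z (J_bracket A V p v (tc c) + J_bracket A W p v (tc c)) = 0"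
      using B(2) by (simp add: h linear_add[OF lin])
    moreover have "((\<lambda>z. T.rep (tc c) V z + T.rep (tc c) W z) has_derivative
        (\<lambda>h. fd (T.rep (tc c) V) ?z h + fd (T.rep (tc c) W) ?z h)) (at ?z)"
      by (intro has_derivative_add fd_works T.diff_fieldD(3) vertical_fieldD(4) V W c p)
    from fun_cong[OF fd_eqI[OF this]]
    have "J_bracket A (V + W) p v (tc c) = J_bracket A V p v (tc c) + J_bracket A W p v (tc c)"
      unfolding JU(2) JV(2) JW(2) by simp
    ultimately show "d_along (tangent_atlas A) (J_bracket A (V + W)) E p v = 0"
      using differential_E_chart[OF c(1) p c(2) JU(1)] by (simp add: d_along_def)
  qed
qed

end

theorem theorem2:
  fixes A :: "('a, 'e::euclidean_space) chart set"
    and E :: "('a, 'e) tpoint \<Rightarrow> real"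
    and V :: "('a, 'e) tpoint \<Rightarrow> (('a, 'e) tpoint, 'e \<times> 'e) tvec"
  assumes "finsler_manifold A E"
    and "vertical_field A (tangent_bundle A) V"
    and "conservative_connection A E (L_connection A E (J_bracket A V))"
  shows "conservative_field A E
    (V + sharp A E (d_along (tangent_atlas A) (J_bracket A V) E))"
proof -
  interpret finsler A E
    using assms(1) by unfold_locales (simp_all add: finsler_manifold_def smooth_manifold_def)
  show ?thesis
    by (rule conservative_L_connection[OF vertical_field_subset[OF assms(2)] assms(3)])
qed

end
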